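(* Let $a,b,c,d$ be surjective submersions, let $\mu:a\to b$ and $\nu:d\to c$ be maps of submersions, and let $\psi:c\to b$ and $\varphi:d\to a$ be interconnection morphisms such that $\psi\circ\nu=\mu\circ\varphi$ (i.e. these form a 2-cell in the double category of submersions whose horizontal 1-morphisms are maps of submersions and whose vertical 1-morphisms are interconnection morphisms). Then the linear maps $\varphi^*:\mathsf{Crl}(a)\to\mathsf{Crl}(d)$ and $\psi^*:\mathsf{Crl}(b)\to\mathsf{Crl}(c)$ form a 2-cell, in the double category of vector spaces, linear maps and linear relations, from the relation $\mathsf{Crl}(\mu)$ to the relation $\mathsf{Crl}(\nu)$; that is, $(\psi^*\times\varphi^* )(\mathsf{Crl}(\mu))\subseteq\mathsf{Crl}(\nu)$. In other words, if open systems $F\in\mathsf{Crl}(a)$ and $G\in\mathsf{Crl}(b)$ are $\mu$-related, then $\varphi^*F$ and $\psi^*G$ are $\nu$-related.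
   Context: Manifolds and maps are smooth. A surjective submersion is written $a=(a_{\mathsf{tot}}\xrightarrow{p_a}a_{\mathsf{st}})$. A map of submersions $f:a\to b$ is a pair of smooth maps $f_{\mathsf{tot}}:a_{\mathsf{tot}}\to b_{\mathsf{tot}}$, $f_{\mathsf{st}}:a_{\mathsf{st}}\to b_{\mathsf{st}}$ with $p_b\circ f_{\mathsf{tot}}=f_{\mathsf{st}}\circ p_a$. $\mathsf{Crl}(a)$ is the real vector space of open systems on $a$: smooth maps $F:a_{\mathsf{tot}}\to T a_{\mathsf{st}}$ with $F(q)\in T_{p_a(q)}a_{\mathsf{st}}$ for all $q\in a_{\mathsf{tot}}$. For a map $f:a\to b$, $F\in\mathsf{Crl}(a)$ and $G\in\mathsf{Crl}(b)$ are $f$-related if $Tf_{\mathsf{st}}\circ F=G\circ f_{\mathsf{tot}}$, and $\mathsf{Crl}(f):=\{(G,F)\in\mathsf{Crl}(b)\times\mathsf{Crl}(a)\mid F,G\text{ are }f\text{-related}\}$, a linear relation from $\mathsf{Crl}(a)$ to $\mathsf{Crl}(b)$. A linear relation from $V$ to $W$ is a linear subspace $R\subseteq W\times V$. In the double category of vector spaces, linear maps and linear relations, a 2-cell from $R\subseteq W\times V$ to $S\subseteq Y\times X$ is a pair of linear maps $h:V\to X$, $g:W\to Y$ with $(g\times h)(R)\subseteq S$. An interconnection morphism is a map of submersions $\varphi:a\to b$ with $\varphi_{\mathsf{st}}$ a diffeomorphism. It induces the linear map $\varphi^*:\mathsf{Crl}(b)\to\mathsf{Crl}(a)$, $\varphi^*F=T(\varphi_{\mathsf{st}})^{-1}\circ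 F\circ\varphi_{\mathsf{tot}}$. *)

theory Defs
  imports "HOL-Analysis.Analysis" "Jordan_Normal_Form.VS_Connect"
begin

text \<open>
  Charts take values in finite-dimensional inner product spaces, so every manifold below has one
  dimension, fixed by the type. The axiom is that of the class
  \<open>euclidean_space\<close> without the nonemptiness of the basis, so that zero-dimensional manifolds
  are covered as well.
\<close>

class euclidean_model = real_inner +
  assumes ex_orthonormal_basis:
    "\<exists>B. finite B \<and> (\<forall>u\<in>B. \<forall>v\<in>B. inner u v = (if u = v then 1 else 0)) \<and>
         (\<forall>x. (\<forall>u\<in>B. inner x u = 0) \<longleftrightarrow> x = 0)"

instance euclidean_space \<subseteq> euclidean_model
  by standard (intro exI[of _ Basis], simp add: inner_Basis euclidean_all_zero_iff)

instance prod :: (euclidean_model, euclidean_model) euclidean_model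
proof
  obtain A :: "'a set" where A: "finite A"
    "\<And>u v. u \<in> A \<Longrightarrow> v \<in> A \<Longrightarrow> inner u v = (if u = v then 1 else 0)"
    "\<And>x. (\<forall>u\<in>A. inner x u = 0) \<longleftrightarrow> x = 0"
    using ex_orthonormal_basis by metis
  obtain B :: "'b set" where B: "finite B"
    "\<And>u v. u \<in> B \<Longrightarrow> v \<in> B \<Longrightarrow> inner u v = (if u = v then 1 else 0)"
    "\<And>x. (\<forall>u\<in>B. inner x u = 0) \<longleftrightarrow> x = 0"
    using ex_orthonormal_basis by metis
  have nz: "0 \<notin> A" "0 \<notin> B"
    using A(2)[of 0 0] B(2)[of 0 0] by auto
  let ?C = "(\<lambda>u. (u, 0)) ` A \<union> (\<lambda>v. (0, v)) ` B"
  have "finite ?C" using A(1) B(1) by simp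
  moreover have "\<forall>u\<in>?C. \<forall>v\<in>?C. inner u v = (if u = v then 1 else 0)"
    using nz A(2) B(2) by (auto simp: inner_Pair split: if_splits)
  moreover have "\<forall>x. (\<forall>u\<in>?C. inner x u = 0) \<longleftrightarrow> x = 0"
    using A(3) B(3) by (auto simp: ball_Un inner_Pair_0 zero_prod_def)
  ultimately show "\<exists>B::('a \<times> 'b) set. finite B \<and>
      (\<forall>u\<in>B. \<forall>v\<in>B. inner u v = (if u = v then 1 else 0)) \<and>
      (\<forall>x. (\<forall>u\<in>B. inner x u = 0) \<longleftrightarrow> x = 0)"
    by blast
qed

datatype zero_space = Origin

instantiation zero_space :: euclidean_model
begin

definition "(0::zero_space) = Origin"
definition "(x::zero_space) + y = Origin"
definition "(x::zero_space) - y = Origin"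
definition "- (x::zero_space) = Origin"
definition "r *\<^sub>R (x::zero_space) = Origin"
definition "inner (x::zero_space) y = (0::real)"
definition "norm (x::zero_space) = (0::real)"
definition "dist (x::zero_space) y = (0::real)"
definition "sgn (x::zero_space) = Origin"
definition "uniformity = (INF e\<in>{0 <..}. principal {(x::zero_space, y). dist x y < e})"
definition "open (U::zero_space set) =
  (\<forall>x\<in>U. eventually (\<lambda>(x', y). x' = x \<longrightarrow> y \<in> U) uniformity)"

instance
proof
  have eq: "x = y" for x y :: zero_space
    by (cases x; cases y; simp)
  show "\<exists>B::zero_space set. finite B \<and>
      (\<forall>u\<in>B. \<forall>v\<in>B. inner u v = (if u = v then 1 else 0)) \<and>
      (\<forall>x. (\<forall>u\<in>B. inner x u = 0) \<longleftrightarrow> x = 0)"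
    using eq by (intro exI[of _ "{}"]) auto
qed (simp_all add: zero_zero_space_def plus_zero_space_def minus_zero_space_def
    uminus_zero_space_def scaleR_zero_space_def inner_zero_space_def norm_zero_space_def
    dist_zero_space_def sgn_zero_space_def uniformity_zero_space_def open_zero_space_def
    zero_space.nchotomy,
    (metis zero_space.exhaust)+)

end

text \<open>
  \<open>f\<close> is of class $C^k$ on the open set \<open>S\<close>; as the model spaces are finite-dimensional, it
  suffices to differentiate along each fixed direction \<open>v\<close>.
\<close>

primrec Ck_on ::
  "nat \<Rightarrow> 'd::real_normed_vector set \<Rightarrow> ('d \<Rightarrow> 'e::real_normed_vector) \<Rightarrow> bool" where
  "Ck_on 0 S f \<longleftrightarrow> continuous_on S f"
| "Ck_on (Suc k) S f \<longleftrightarrow>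
     (\<forall>x\<in>S. f differentiable (at x)) \<and> (\<forall>v. Ck_on k S (\<lambda>x. frechet_derivative f (at x) v))"

definition smooth_on ::
  "'d::real_normed_vector set \<Rightarrow> ('d \<Rightarrow> 'e::real_normed_vector) \<Rightarrow> bool" where
  "smooth_on S f \<longleftrightarrow> (\<forall>k. Ck_on k S f)"

text \<open>A chart is given by its domain and its coordinate map (irrelevant off the domain).\<close>

type_synonym ('m, 'e) chart = "'m set \<times> ('m \<Rightarrow> 'e)"

definition chart_inv :: "('m, 'e) chart \<Rightarrow> 'e \<Rightarrow> 'm" where
  "chart_inv \<kappa> = inv_into (fst \<kappa>) (snd \<kappa>)"

text \<open>The atlas generates the smooth structure; it is not required to be maximal.\<close>

record ('m, 'e) mfd =
  mtop :: "'m topology"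
  atlas :: "('m, 'e) chart set"

abbreviation points :: "('m, 'e) mfd \<Rightarrow> 'm set" where
  "points M \<equiv> topspace (mtop M)"

definition manifold :: "('m, 'e::euclidean_model) mfd \<Rightarrow> bool" where
  "manifold M \<longleftrightarrow>
     Hausdorff_space (mtop M) \<and> second_countable (mtop M) \<and>
     (\<forall>\<kappa>\<in>atlas M. openin (mtop M) (fst \<kappa>) \<and> open (snd \<kappa> ` fst \<kappa>) \<and>
        homeomorphic_map (subtopology (mtop M) (fst \<kappa>)) (top_of_set (snd \<kappa> ` fst \<kappa>)) (snd \<kappa>)) \<and>
     (\<Union>\<kappa>\<in>atlas M. fst \<kappa>) = points M \<and>
     (\<forall>\<kappa>\<in>atlas M. \<forall>\<kappa>'\<in>atlas M.
        smooth_on (snd \<kappa> ` (fst \<kappa> \<inter> fst \<kappa>')) (snd \<kappa>' \<circ> chart_inv \<kappa>))"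

definition smooth_map ::
  "('m, 'd::real_normed_vector) mfd \<Rightarrow> ('n, 'e::real_normed_vector) mfd \<Rightarrow> ('m \<Rightarrow> 'n) \<Rightarrow> bool" where
  "smooth_map M N f \<longleftrightarrow>
     continuous_map (mtop M) (mtop N) f \<and>
     (\<forall>\<kappa>\<in>atlas M. \<forall>\<kappa>'\<in>atlas N.
        smooth_on (snd \<kappa> ` (fst \<kappa> \<inter> f -` fst \<kappa>')) (snd \<kappa>' \<circ> f \<circ> chart_inv \<kappa>))"

definition diffeomorphism ::
  "('m, 'd::real_normed_vector) mfd \<Rightarrow> ('n, 'e::real_normed_vector) mfd \<Rightarrow> ('m \<Rightarrow> 'n) \<Rightarrow> bool" where
  "diffeomorphism M N f \<longleftrightarrow>
     smooth_map M N f \<and>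
     (\<exists>g. smooth_map N M g \<and> (\<forall>x\<in>points M. g (f x) = x) \<and> (\<forall>y\<in>points N. f (g y) = y))"

definition charts_at :: "('m, 'e) mfd \<Rightarrow> 'm \<Rightarrow> ('m, 'e) chart set" where
  "charts_at M x = {\<kappa> \<in> atlas M. x \<in> fst \<kappa>}"

text \<open>
  A tangent vector at \<open>x\<close> is the family of its coordinate vectors in the charts around \<open>x\<close>, which
  transform by the derivatives of the coordinate changes. The value \<open>0\<close> at the remaining indices
  makes the representation unique.
\<close>

definition tangent_space ::
  "('m, 'e::real_normed_vector) mfd \<Rightarrow> 'm \<Rightarrow> (('m, 'e) chart \<Rightarrow> 'e) set" where
  "tangent_space M x =
     {v. (\<forall>\<kappa>. \<kappa> \<notin> charts_at M x \<longrightarrow> v \<kappa> = 0) \<and>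
         (\<forall>\<kappa>\<in>charts_at M x. \<forall>\<kappa>'\<in>charts_at M x.
            v \<kappa>' = frechet_derivative (snd \<kappa>' \<circ> chart_inv \<kappa>) (at (snd \<kappa> x)) (v \<kappa>))}"

type_synonym ('m, 'e) tvec = "'m \<times> (('m, 'e) chart \<Rightarrow> 'e)"

definition tangent_chart ::
  "('m, 'e::real_normed_vector) mfd \<Rightarrow> ('m, 'e) chart \<Rightarrow> (('m, 'e) tvec, 'e \<times> 'e) chart" where
  "tangent_chart M \<kappa> = (Sigma (fst \<kappa>) (tangent_space M), \<lambda>(x, v). (snd \<kappa> x, v \<kappa>))"

definition tangent_bundle ::
  "('m, 'e::real_normed_vector) mfd \<Rightarrow> (('m, 'e) tvec, 'e \<times> 'e) mfd" where
  "tangent_bundle M =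
     \<lparr>mtop = topology_generated_by
        {fst (tangent_chart M \<kappa>) \<inter> snd (tangent_chart M \<kappa>) -` W | \<kappa> W. \<kappa> \<in> atlas M \<and> open W},
      atlas = tangent_chart M ` atlas M\<rparr>"

text \<open>
  The tangent map $Tf$. By the chain rule its value on a tangent vector at \<open>x\<close> does not depend on
  the chart around \<open>x\<close> that is chosen to compute it.
\<close>

definition tangent_map ::
  "('m, 'd::real_normed_vector) mfd \<Rightarrow> ('n, 'e::real_normed_vector) mfd \<Rightarrow> ('m \<Rightarrow> 'n) \<Rightarrow>
   ('m, 'd) tvec \<Rightarrow> ('n, 'e) tvec" where
  "tangent_map M N f = (\<lambda>(x, v).
     (f x, \<lambda>\<kappa>'. if \<kappa>' \<in> charts_at N (f x)
                then let \<kappa> = SOME \<kappa>. \<kappa> \<in> charts_at M x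
                     in frechet_derivative (snd \<kappa>' \<circ> f \<circ> chart_inv \<kappa>) (at (snd \<kappa> x)) (v \<kappa>)
                else 0))"

record ('x, 'd, 'y, 'e) submersion =
  sub_tot :: "('x, 'd) mfd"
  sub_st :: "('y, 'e) mfd"
  sub_proj :: "'x \<Rightarrow> 'y"

definition surj_submersion ::
  "('x, 'd::euclidean_model, 'y, 'e::euclidean_model) submersion \<Rightarrow> bool" where
  "surj_submersion a \<longleftrightarrow>
     manifold (sub_tot a) \<and> manifold (sub_st a) \<and>
     smooth_map (sub_tot a) (sub_st a) (sub_proj a) \<and>
     sub_proj a ` points (sub_tot a) = points (sub_st a) \<and>
     (\<forall>q\<in>points (sub_tot a).
        tangent_map (sub_tot a) (sub_st a) (sub_proj a) ` ({q} \<times> tangent_space (sub_tot a) q) =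
        {sub_proj a q} \<times> tangent_space (sub_st a) (sub_proj a q))"

record ('x, 'y, 'x2, 'y2) submap =
  map_tot :: "'x \<Rightarrow> 'x2"
  map_st :: "'y \<Rightarrow> 'y2"

definition submersion_map ::
  "('x, 'd::euclidean_model, 'y, 'e::euclidean_model) submersion \<Rightarrow>
   ('x2, 'd2::euclidean_model, 'y2, 'e2::euclidean_model) submersion \<Rightarrow>
   ('x, 'y, 'x2, 'y2) submap \<Rightarrow> bool" where
  "submersion_map a b f \<longleftrightarrow>
     smooth_map (sub_tot a) (sub_tot b) (map_tot f) \<and>
     smooth_map (sub_st a) (sub_st b) (map_st f) \<and>
     (\<forall>q\<in>points (sub_tot a). sub_proj b (map_tot f q) = map_st f (sub_proj a q))"

definition submap_comp ::
  "('x2, 'y2, 'x3, 'y3) submap \<Rightarrow> ('x, 'y, 'x2, 'y2) submap \<Rightarrow> ('x, 'y, 'x3, 'y3) submap" where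
  "submap_comp g f = \<lparr>map_tot = map_tot g \<circ> map_tot f, map_st = map_st g \<circ> map_st f\<rparr>"

text \<open>Equality of maps of submersions with source \<open>a\<close>: only the values on the manifolds count.\<close>

definition submap_eq ::
  "('x, 'd, 'y, 'e) submersion \<Rightarrow> ('x, 'y, 'x2, 'y2) submap \<Rightarrow> ('x, 'y, 'x2, 'y2) submap \<Rightarrow> bool" where
  "submap_eq a f g \<longleftrightarrow>
     (\<forall>q\<in>points (sub_tot a). map_tot f q = map_tot g q) \<and>
     (\<forall>y\<in>points (sub_st a). map_st f y = map_st g y)"

definition interconnection ::
  "('x, 'd::euclidean_model, 'y, 'e::euclidean_model) submersion \<Rightarrow>
   ('x2, 'd2::euclidean_model, 'y2, 'e2::euclidean_model) submersion \<Rightarrow>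
   ('x, 'y, 'x2, 'y2) submap \<Rightarrow> bool" where
  "interconnection a b f \<longleftrightarrow>
     submersion_map a b f \<and> diffeomorphism (sub_st a) (sub_st b) (map_st f)"

text \<open>
  Open systems are extensional functions (\<open>undefined\<close> off the total space), so that equality in
  \<open>Crl a\<close> is equality of maps. The ring multiplication and unit of the record are irrelevant for a
  module and filled with the zero system.
\<close>

definition Crl ::
  "('x, 'd::euclidean_model, 'y, 'e::euclidean_model) submersion \<Rightarrow>
   (real, 'x \<Rightarrow> ('y, 'e) tvec) module" where
  "Crl a =
     (let Q = points (sub_tot a); p = sub_proj a; Z = (\<lambda>q\<in>Q. (p q, \<lambda>\<kappa>. 0)) in
     \<lparr>carrier = {F \<in> extensional Q.
         smooth_map (sub_tot a) (tangent_bundle (sub_st a)) F \<and>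
         (\<forall>q\<in>Q. F q \<in> {p q} \<times> tangent_space (sub_st a) (p q))},
      monoid.mult = (\<lambda>F G. Z), one = Z, zero = Z,
      add = (\<lambda>F G. \<lambda>q\<in>Q. (p q, \<lambda>\<kappa>. snd (F q) \<kappa> + snd (G q) \<kappa>)),
      smult = (\<lambda>r F. \<lambda>q\<in>Q. (p q, \<lambda>\<kappa>. r *\<^sub>R snd (F q) \<kappa>))\<rparr>)"

definition related ::
  "('x, 'd::euclidean_model, 'y, 'e::euclidean_model) submersion \<Rightarrow>
   ('x2, 'd2::euclidean_model, 'y2, 'e2::euclidean_model) submersion \<Rightarrow>
   ('x, 'y, 'x2, 'y2) submap \<Rightarrow> ('x \<Rightarrow> ('y, 'e) tvec) \<Rightarrow> ('x2 \<Rightarrow> ('y2, 'e2) tvec) \<Rightarrow> bool" where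
  "related a b f F G \<longleftrightarrow>
     (\<forall>q\<in>points (sub_tot a).
        tangent_map (sub_st a) (sub_st b) (map_st f) (F q) = G (map_tot f q))"

definition Crl_rel ::
  "('x, 'd::euclidean_model, 'y, 'e::euclidean_model) submersion \<Rightarrow>
   ('x2, 'd2::euclidean_model, 'y2, 'e2::euclidean_model) submersion \<Rightarrow>
   ('x, 'y, 'x2, 'y2) submap \<Rightarrow> (('x2 \<Rightarrow> ('y2, 'e2) tvec) \<times> ('x \<Rightarrow> ('y, 'e) tvec)) set" where
  "Crl_rel a b f =
     {(G, F). G \<in> carrier (Crl b) \<and> F \<in> carrier (Crl a) \<and> related a b f F G}"

text \<open>
  $\varphi^* F = T(\varphi_{st})^{-1} \circ F \circ \varphi_{tot}$, with $T(\varphi_{st})^{-1}$ the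
  inverse on the total space of the tangent bundle.
\<close>

definition pullback ::
  "('x, 'd::euclidean_model, 'y, 'e::euclidean_model) submersion \<Rightarrow>
   ('x2, 'd2::euclidean_model, 'y2, 'e2::euclidean_model) submersion \<Rightarrow>
   ('x, 'y, 'x2, 'y2) submap \<Rightarrow> ('x2 \<Rightarrow> ('y2, 'e2) tvec) \<Rightarrow> 'x \<Rightarrow> ('y, 'e) tvec" where
  "pullback a b f F = (\<lambda>q\<in>points (sub_tot a).
     inv_into (points (tangent_bundle (sub_st a)))
       (tangent_map (sub_st a) (sub_st b) (map_st f)) (F (map_tot f q)))"

definition linear_relation ::
  "(real, 'v) module \<Rightarrow> (real, 'w) module \<Rightarrow> ('w \<times> 'v) set \<Rightarrow> bool" where
  "linear_relation V W R \<longleftrightarrow>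
     vectorspace class_ring V \<and> vectorspace class_ring W \<and>
     VectorSpace.subspace class_ring R (direct_sum W V)"

definition vect_two_cell ::
  "(real, 'v) module \<Rightarrow> (real, 'w) module \<Rightarrow> ('w \<times> 'v) set \<Rightarrow>
   (real, 'x) module \<Rightarrow> (real, 'y) module \<Rightarrow> ('y \<times> 'x) set \<Rightarrow>
   ('v \<Rightarrow> 'x) \<Rightarrow> ('w \<Rightarrow> 'y) \<Rightarrow> bool" where
  "vect_two_cell V W R X Y S h g \<longleftrightarrow>
     linear_relation V W R \<and> linear_relation X Y S \<and>
     linear_map class_ring V X h \<and> linear_map class_ring W Y g \<and>
     map_prod g h ` R \<subseteq> S"

end

theory Submission
  imports Defs
begin

text \<open>
  The inclusion is functoriality of the tangent map. Let $F$ and $G$ be $\mu$-related and let $q$ be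
  a point of the total space of $d$. Applying $T\psi_{st}$ to
  $T\nu_{st}((\varphi^* F)(q))$ gives, by the commuting square on states,
  $T\mu_{st}(T\varphi_{st}((\varphi^* F)(q))) = T\mu_{st}(F(\varphi_{tot}(q)))$; this is
  $G(\mu_{tot}(\varphi_{tot}(q)))$ by relatedness and $G(\psi_{tot}(\nu_{tot}(q)))$ by the commuting
  square on total spaces, that is, $T\psi_{st}((\psi^* G)(\nu_{tot}(q)))$. Since $\psi_{st}$ is a
  diffeomorphism, $T\psi_{st}$ is injective and can be cancelled. This is \<open>pullback_related\<close>;
  it rests on \<open>tangent_map_compose\<close> and \<open>tangent_map_inverse\<close>.

  The other half is that all objects of the 2-cell live where they should: \<open>Crl\<close> is a vector
  space, relatedness is a linear relation, and $\varphi^*$ maps open systems linearly to open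
  systems. Linearity comes from linearity of the derivative
  (\<open>tangent_map_combination\<close>). Smoothness is reduced to coordinates by
  \<open>smooth_section_iff\<close>: a section of the tangent bundle along a smooth map is smooth iff its
  coordinate vectors are smooth functions at every point. In coordinates $\varphi^* F$ is the
  derivative of a smooth map, at a base point depending smoothly on the parameter, applied to a
  vector depending smoothly on the parameter.

  Smoothness is defined through directional derivatives along fixed vectors, so both this last
  expression and the chain rule need the expansion of the varying vector in a finite orthonormal
  basis (\<open>Ck_on_compose\<close>, \<open>smooth_near_derivative_apply\<close>). This is where the finite
  dimension of the model spaces enters.
\<close>

section \<open>Calculus of smooth germs between model spaces\<close>

lemma Ck_on_subset: "Ck_on k S f \<Longrightarrow> T \<subseteq> S \<Longrightarrow> Ck_on k T f"
  by (induction k arbitrary: f) (auto intro: continuous_on_subset)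

text \<open>
  A differentiable function is continuous; this starts the descent from one level to the next.
\<close>

lemma Ck_on_lower: "Ck_on (Suc k) S f \<Longrightarrow> Ck_on k S f"
proof (induction k arbitrary: f)
  case 0
  then show ?case
    by (auto intro!: continuous_at_imp_continuous_on differentiable_imp_continuous_within)
next
  case (Suc k)
  have "Ck_on k S (\<lambda>x. frechet_derivative f (at x) v)" for v
    using Suc.prems by (intro Suc.IH) simp
  then show ?case using Suc.prems by simp
qed

lemma frechet_derivative_cong:
  assumes "\<forall>\<^sub>F y in nhds x. f y = g y"
  shows "frechet_derivative f (at x) = frechet_derivative g (at x)"
proof -
  from assms obtain V where V: "open V" "x \<in> V" "\<And>y. y \<in> V \<Longrightarrow> f y = g y"
    by (auto simp: eventually_nhds)
  have "(f has_derivative D) (at x) \<longleftrightarrow> (g has_derivative D) (at x)" for D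
    using V by (metis has_derivative_transform_within_open)
  then show ?thesis unfolding frechet_derivative_def by simp
qed

lemma differentiable_cong:
  assumes "\<forall>\<^sub>F y in nhds x. f y = g y" and "f differentiable (at x)"
  shows "g differentiable (at x)"
proof -
  from assms obtain V where "open V" "x \<in> V" "\<And>y. y \<in> V \<Longrightarrow> f y = g y"
    by (auto simp: eventually_nhds)
  then show ?thesis
    using assms(2) has_derivative_transform_within_open[of f _ x UNIV]
    unfolding differentiable_def by blast
qed

lemma Ck_on_cong:
  assumes "open S" "\<And>x. x \<in> S \<Longrightarrow> f x = g x" "Ck_on k S f"
  shows "Ck_on k S g"
  using assms(2,3)
proof (induction k arbitrary: f g)
  case 0
  then show ?case by (metis Ck_on.simps(1) continuous_on_cong)
next
  case (Suc k)
  have ev: "\<forall>\<^sub>F y in nhds x. f y = g y" if "x \<in> S" for x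
    using assms(1) Suc.prems(1) that by (auto simp: eventually_nhds)
  have "Ck_on k S (\<lambda>x. frechet_derivative g (at x) v)" for v
  proof (rule Suc.IH)
    show "frechet_derivative f (at x) v = frechet_derivative g (at x) v" if "x \<in> S" for x
      by (simp only: frechet_derivative_cong[OF ev[OF that]])
    show "Ck_on k S (\<lambda>x. frechet_derivative f (at x) v)"
      using Suc.prems(2) by simp
  qed
  moreover have "g differentiable (at x)" if "x \<in> S" for x
    using differentiable_cong[OF ev[OF that]] Suc.prems(2) that by simp
  ultimately show ?case by simp
qed

text \<open>
  Continuity and differentiability at a point, and the derivative there, depend only on the values
  in a neighbourhood.
\<close>

lemma Ck_on_local:
  assumes "\<And>x. x \<in> S \<Longrightarrow> \<exists>V. open V \<and> x \<in> V \<and> Ck_on k V f"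
  shows "Ck_on k S f"
  using assms
proof (induction k arbitrary: f)
  case 0
  have "isCont f x" if "x \<in> S" for x
  proof -
    obtain V where "open V" "x \<in> V" "continuous_on V f"
      using "0.prems"[OF \<open>x \<in> S\<close>] by auto
    then show ?thesis by (simp add: continuous_on_eq_continuous_at)
  qed
  then show ?case by (simp add: continuous_at_imp_continuous_on)
next
  case (Suc k)
  have "Ck_on k S (\<lambda>x. frechet_derivative f (at x) v)" for v
  proof (rule Suc.IH)
    fix x assume "x \<in> S"
    then obtain V where "open V" "x \<in> V" "Ck_on (Suc k) V f" using Suc.prems by blast
    then show "\<exists>V. open V \<and> x \<in> V \<and> Ck_on k V (\<lambda>x. frechet_derivative f (at x) v)" by auto
  qed
  moreover have "f differentiable (at x)" if "x \<in> S" for x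
  proof -
    obtain V where "x \<in> V" "Ck_on (Suc k) V f" using Suc.prems \<open>x \<in> S\<close> by blast
    then show ?thesis by simp
  qed
  ultimately show ?case by simp
qed

lemma Ck_on_const: "Ck_on k S (\<lambda>x. c)"
  by (induction k arbitrary: c) auto

lemma Ck_on_add:
  assumes "open S"
  shows "Ck_on k S f \<Longrightarrow> Ck_on k S g \<Longrightarrow> Ck_on k S (\<lambda>x. f x + g x)"
proof (induction k arbitrary: f g)
  case 0
  then show ?case by (simp add: continuous_on_add)
next
  case (Suc k)
  have "Ck_on k S (\<lambda>x. frechet_derivative (\<lambda>x. f x + g x) (at x) v)" for v
  proof (rule Ck_on_cong[OF assms])
    show "Ck_on k S (\<lambda>x. frechet_derivative f (at x) v + frechet_derivative g (at x) v)"
      using Suc by auto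
    show "frechet_derivative f (at x) v + frechet_derivative g (at x) v =
        frechet_derivative (\<lambda>x. f x + g x) (at x) v" if "x \<in> S" for x
    proof -
      have "((\<lambda>x. f x + g x) has_derivative
          (\<lambda>v. frechet_derivative f (at x) v + frechet_derivative g (at x) v)) (at x)"
        using Suc.prems that by (intro has_derivative_add) (auto simp flip: frechet_derivative_works)
      from frechet_derivative_at[OF this] show ?thesis by metis
    qed
  qed
  moreover have "(\<lambda>x. f x + g x) differentiable (at x)" if "x \<in> S" for x
    using Suc.prems that by (intro differentiable_add) simp_all
  ultimately show ?case by simp
qed

lemma frechet_derivative_bounded_linear:
  assumes "bounded_linear L" "f differentiable (at x)"
  shows "frechet_derivative (\<lambda>x. L (f x)) (at x) v = L (frechet_derivative f (at x) v)"
proof -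
  have "((\<lambda>x. L (f x)) has_derivative (\<lambda>v. L (frechet_derivative f (at x) v))) (at x)"
    using assms by (intro bounded_linear.has_derivative[OF assms(1)])
      (simp add: frechet_derivative_works)
  from frechet_derivative_at[OF this] show ?thesis by metis
qed

lemma Ck_on_bounded_linear:
  assumes "bounded_linear L" "open S"
  shows "Ck_on k S f \<Longrightarrow> Ck_on k S (\<lambda>x. L (f x))"
proof (induction k arbitrary: f)
  case 0
  then show ?case by (simp add: bounded_linear.continuous_on[OF assms(1)])
next
  case (Suc k)
  have "Ck_on k S (\<lambda>x. frechet_derivative (\<lambda>x. L (f x)) (at x) v)" for v
  proof (rule Ck_on_cong[OF assms(2)])
    show "Ck_on k S (\<lambda>x. L (frechet_derivative f (at x) v))"
      using Suc by auto
  qed (use Suc.prems frechet_derivative_bounded_linear[OF assms(1)] in force)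
  moreover have "(\<lambda>x. L (f x)) differentiable (at x)" if "x \<in> S" for x
  proof -
    have "(f has_derivative frechet_derivative f (at x)) (at x)"
      using Suc.prems that by (simp flip: frechet_derivative_works)
    then show ?thesis
      using bounded_linear.has_derivative[OF assms(1)] unfolding differentiable_def by blast
  qed
  ultimately show ?case by simp
qed

text \<open>
  By the product rule the derivative of a product of $C^{k+1}$ functions is a sum of products of
  $C^k$ functions; this uses that each factor is in particular itself $C^k$.
\<close>

lemma Ck_on_scaleR:
  fixes f :: "'d::real_normed_vector \<Rightarrow> real"
  assumes "open S"
  shows "Ck_on k S f \<Longrightarrow> Ck_on k S g \<Longrightarrow> Ck_on k S (\<lambda>x. f x *\<^sub>R g x)"
proof (induction k arbitrary: f g)
  case 0
  then show ?case by (simp add: continuous_on_scaleR)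
next
  case (Suc k)
  have D: "((\<lambda>x. f x *\<^sub>R g x) has_derivative
      (\<lambda>v. f x *\<^sub>R frechet_derivative g (at x) v + frechet_derivative f (at x) v *\<^sub>R g x)) (at x)"
    if "x \<in> S" for x
    using Suc.prems that by (intro has_derivative_scaleR) (auto simp flip: frechet_derivative_works)
  have "Ck_on k S (\<lambda>x. frechet_derivative (\<lambda>x. f x *\<^sub>R g x) (at x) v)" for v
  proof (rule Ck_on_cong[OF assms])
    show "Ck_on k S (\<lambda>x. f x *\<^sub>R frechet_derivative g (at x) v + frechet_derivative f (at x) v *\<^sub>R g x)"
      using Suc.prems Ck_on_lower[OF Suc.prems(1)] Ck_on_lower[OF Suc.prems(2)]
      by (intro Ck_on_add[OF assms] Suc.IH) auto
    show "f x *\<^sub>R frechet_derivative g (at x) v + frechet_derivative f (at x) v *\<^sub>R g x =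
        frechet_derivative (\<lambda>x. f x *\<^sub>R g x) (at x) v" if "x \<in> S" for x
      by (simp flip: frechet_derivative_at[OF D[OF that]])
  qed
  then show ?case using D by (auto simp: differentiable_def)
qed

lemma Ck_on_sum:
  assumes "open S" "finite B" "\<And>b. b \<in> B \<Longrightarrow> Ck_on k S (f b)"
  shows "Ck_on k S (\<lambda>x. \<Sum>b\<in>B. f b x)"
  using assms(2,3) by (induction B) (simp_all add: Ck_on_add[OF assms(1)] Ck_on_const)

definition orthonormal_basis :: "'e::real_inner set \<Rightarrow> bool" where
  "orthonormal_basis B \<longleftrightarrow> finite B \<and>
     (\<forall>u\<in>B. \<forall>v\<in>B. inner u v = (if u = v then 1 else 0)) \<and> (\<forall>x. (\<forall>u\<in>B. inner x u = 0) \<longleftrightarrow> x = 0)"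

text \<open>
  The difference of the two sides is orthogonal to every element of \<open>B\<close>, hence zero.
\<close>

lemma orthonormal_expansion:
  assumes "orthonormal_basis B"
  shows "(\<Sum>u\<in>B. inner x u *\<^sub>R u) = x"
proof -
  have B: "finite B" "\<And>u v. u \<in> B \<Longrightarrow> v \<in> B \<Longrightarrow> inner u v = (if u = v then 1 else 0)"
    "\<And>x. (\<forall>u\<in>B. inner x u = 0) \<longleftrightarrow> x = 0"
    using assms unfolding orthonormal_basis_def by auto
  have "inner (x - (\<Sum>u\<in>B. inner x u *\<^sub>R u)) v = 0" if "v \<in> B" for v
  proof -
    have "inner (\<Sum>u\<in>B. inner x u *\<^sub>R u) v = (\<Sum>u\<in>B. if u = v then inner x v else 0)"
      unfolding inner_sum_left by (rule sum.cong) (use B(2) that in auto)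
    then show ?thesis using that B(1) by (simp add: inner_diff_left)
  qed
  then have "x - (\<Sum>u\<in>B. inner x u *\<^sub>R u) = 0" using B(3) by blast
  then show ?thesis by simp
qed

lemma linear_orthonormal_expansion:
  assumes "orthonormal_basis B" "linear L"
  shows "L w = (\<Sum>u\<in>B. inner w u *\<^sub>R L u)"
proof -
  have "L w = L (\<Sum>u\<in>B. inner w u *\<^sub>R u)" using orthonormal_expansion[OF assms(1)] by simp
  also have "\<dots> = (\<Sum>u\<in>B. inner w u *\<^sub>R L u)"
    using assms(2) by (simp add: linear_sum linear_scale)
  finally show ?thesis .
qed

lemma frechet_derivative_chain:
  assumes "f differentiable (at x)" "g differentiable (at (f x))"
  shows "frechet_derivative (\<lambda>x. g (f x)) (at x) v =
    frechet_derivative g (at (f x)) (frechet_derivative f (at x) v)"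
  using frechet_derivative_compose[OF assms] by (simp add: o_def)

text \<open>
  The chain rule gives $D(g \circ f)(x) v = Dg(f(x))(Df(x) v)$. The vector $Df(x) v$ varies with
  $x$, whereas the $C^k$ condition on $g$ speaks only of fixed vectors. Expanded in an orthonormal
  basis, the right-hand side becomes the finite sum of the terms
  $\langle Df(x) v, u \rangle \, Dg(f(x)) u$, to which the induction hypothesis and the product rule
  apply.
\<close>

lemma Ck_on_compose:
  fixes f :: "'d::real_normed_vector \<Rightarrow> 'e::euclidean_model"
  assumes "open S" "open T" "f ` S \<subseteq> T"
  shows "Ck_on k T g \<Longrightarrow> Ck_on k S f \<Longrightarrow> Ck_on k S (\<lambda>x. g (f x))"
  using assms
proof (induction k arbitrary: g f)
  case 0
  then show ?case by (auto intro: continuous_on_compose2)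
next
  case (Suc k)
  obtain B :: "'e set" where B: "orthonormal_basis B"
    using ex_orthonormal_basis unfolding orthonormal_basis_def by auto
  have d: "f differentiable (at x)" "g differentiable (at (f x))" if "x \<in> S" for x
    using Suc.prems that by auto
  have "Ck_on k S (\<lambda>x. frechet_derivative (\<lambda>x. g (f x)) (at x) v)" for v
  proof (rule Ck_on_cong[OF \<open>open S\<close>])
    show "Ck_on k S (\<lambda>x. \<Sum>u\<in>B. inner (frechet_derivative f (at x) v) u *\<^sub>R
        frechet_derivative g (at (f x)) u)"
    proof (rule Ck_on_sum[OF \<open>open S\<close>])
      show "finite B" using B by (simp add: orthonormal_basis_def)
      fix u
      have "Ck_on k S (\<lambda>x. inner (frechet_derivative f (at x) v) u)"
        using Suc.prems by (intro Ck_on_bounded_linear[OF bounded_linear_inner_left]) auto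
      moreover have "Ck_on k S (\<lambda>x. frechet_derivative g (at (f x)) u)"
        using Suc.prems Ck_on_lower[OF Suc.prems(2)]
        by (intro Suc.IH[of "\<lambda>y. frechet_derivative g (at y) u"]) auto
      ultimately show "Ck_on k S (\<lambda>x. inner (frechet_derivative f (at x) v) u *\<^sub>R
          frechet_derivative g (at (f x)) u)"
        using Ck_on_scaleR[OF \<open>open S\<close>] by blast
    qed
    show "(\<Sum>u\<in>B. inner (frechet_derivative f (at x) v) u *\<^sub>R frechet_derivative g (at (f x)) u) =
        frechet_derivative (\<lambda>x. g (f x)) (at x) v" if "x \<in> S" for x
      unfolding frechet_derivative_chain[OF d[OF that]]
      by (rule linear_orthonormal_expansion[OF B linear_frechet_derivative[OF d(2)[OF that]], symmetric])
  qed
  moreover have "(\<lambda>x. g (f x)) differentiable (at x)" if "x \<in> S" for x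
    using d[OF that] differentiable_chain_at[of f x g] by (simp add: o_def)
  ultimately show ?case by simp
qed

text \<open>
  Smoothness of the germ at a point. Working with germs spares the bookkeeping of the domains on
  which coordinate expressions are defined.
\<close>

definition smooth_near :: "('d::real_normed_vector \<Rightarrow> 'e::real_normed_vector) \<Rightarrow> 'd \<Rightarrow> bool" where
  "smooth_near f x \<longleftrightarrow> (\<exists>V. open V \<and> x \<in> V \<and> smooth_on V f)"

lemma smooth_on_iff_near:
  assumes "open S"
  shows "smooth_on S f \<longleftrightarrow> (\<forall>x\<in>S. smooth_near f x)"
proof
  show "smooth_on S f \<Longrightarrow> \<forall>x\<in>S. smooth_near f x"
    using assms by (auto simp: smooth_near_def)
next
  assume near: "\<forall>x\<in>S. smooth_near f x"
  have "Ck_on k S f" for k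
  proof (rule Ck_on_local)
    fix x assume "x \<in> S"
    with near have "smooth_near f x" by simp
    then show "\<exists>V. open V \<and> x \<in> V \<and> Ck_on k V f"
      unfolding smooth_near_def smooth_on_def by blast
  qed
  then show "smooth_on S f" by (simp add: smooth_on_def)
qed

lemma smooth_near_cong:
  assumes "\<forall>\<^sub>F y in nhds x. f y = g y" "smooth_near f x"
  shows "smooth_near g x"
proof -
  obtain U where U: "open U" "x \<in> U" "\<And>y. y \<in> U \<Longrightarrow> f y = g y"
    using assms(1) by (auto simp: eventually_nhds)
  obtain V where V: "open V" "x \<in> V" "smooth_on V f"
    using assms(2) by (auto simp: smooth_near_def)
  have "Ck_on k (U \<inter> V) g" for k
  proof (rule Ck_on_cong)
    show "open (U \<inter> V)" using U(1) V(1) by (rule open_Int)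
    show "Ck_on k (U \<inter> V) f" using V(3) Ck_on_subset[of k V f] by (simp add: smooth_on_def)
  qed (use U in simp)
  then show ?thesis
    unfolding smooth_near_def smooth_on_def using U V by (intro exI[of _ "U \<inter> V"]) auto
qed

lemma smooth_near_const: "smooth_near (\<lambda>x. c) x"
  unfolding smooth_near_def smooth_on_def by (intro exI[of _ UNIV]) (simp add: Ck_on_const)

text \<open>
  Transfers any closure property of $C^k$ functions on an open set to germs, by intersecting the
  two neighbourhoods.
\<close>

lemma smooth_near_combine:
  assumes "smooth_near f x" "smooth_near g x"
    and "\<And>k S. open S \<Longrightarrow> Ck_on k S f \<Longrightarrow> Ck_on k S g \<Longrightarrow> Ck_on k S h"
  shows "smooth_near h x"
proof -
  obtain U V where UV: "open U" "x \<in> U" "smooth_on U f" "open V" "x \<in> V" "smooth_on V g"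
    using assms(1,2) by (auto simp: smooth_near_def)
  have "Ck_on k (U \<inter> V) h" for k
    using UV Ck_on_subset[of k U f] Ck_on_subset[of k V g]
    by (intro assms(3)) (auto simp: smooth_on_def)
  then show ?thesis
    unfolding smooth_near_def smooth_on_def using UV by (intro exI[of _ "U \<inter> V"]) auto
qed

lemma smooth_near_add: "smooth_near f x \<Longrightarrow> smooth_near g x \<Longrightarrow> smooth_near (\<lambda>x. f x + g x) x"
  by (erule (1) smooth_near_combine) (rule Ck_on_add)

lemma smooth_near_scaleR:
  "smooth_near f x \<Longrightarrow> smooth_near g x \<Longrightarrow> smooth_near (\<lambda>x. f x *\<^sub>R g x) x"
  by (erule (1) smooth_near_combine) (rule Ck_on_scaleR)

lemma smooth_near_bounded_linear:
  "bounded_linear L \<Longrightarrow> smooth_near f x \<Longrightarrow> smooth_near (\<lambda>x. L (f x)) x"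
  by (rule smooth_near_combine[of f _ f]) (simp_all add: Ck_on_bounded_linear)

lemma smooth_near_sum:
  assumes "finite B" "\<And>b. b \<in> B \<Longrightarrow> smooth_near (f b) x"
  shows "smooth_near (\<lambda>x. \<Sum>b\<in>B. f b x) x"
  using assms by (induction B) (simp_all add: smooth_near_add smooth_near_const)

lemma smooth_near_Pair:
  assumes "smooth_near f x" "smooth_near g x"
  shows "smooth_near (\<lambda>x. (f x, g x)) x"
proof -
  have L: "bounded_linear (\<lambda>y. (y, 0))" "bounded_linear (Pair 0)"
    by (intro bounded_linear_Pair bounded_linear_ident bounded_linear_zero)+
  show ?thesis
    using smooth_near_add[OF smooth_near_bounded_linear[OF L(1) assms(1)]
        smooth_near_bounded_linear[OF L(2) assms(2)]] by simp
qed

lemma smooth_near_imp_differentiable: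
  assumes "smooth_near f x" shows "f differentiable (at x)"
proof -
  obtain V where "x \<in> V" "\<And>k. Ck_on k V f"
    using assms unfolding smooth_near_def smooth_on_def by blast
  then have "x \<in> V" "Ck_on (Suc 0) V f" by blast+
  then show ?thesis by simp
qed

lemma smooth_near_frechet_derivative:
  assumes "smooth_near f x" shows "smooth_near (\<lambda>y. frechet_derivative f (at y) v) x"
proof -
  obtain V where V: "open V" "x \<in> V" "\<And>k. Ck_on k V f"
    using assms unfolding smooth_near_def smooth_on_def by blast
  have "Ck_on k V (\<lambda>y. frechet_derivative f (at y) v)" for k
    using V(3)[of "Suc k"] by simp
  then show ?thesis
    unfolding smooth_near_def smooth_on_def using V(1,2) by blast
qed

lemma smooth_near_eventually: "smooth_near f x \<Longrightarrow> \<forall>\<^sub>F y in nhds x. smooth_near f y"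
  unfolding smooth_near_def eventually_nhds by (elim exE, rule exI) auto

lemma smooth_near_compose:
  fixes f :: "'d::real_normed_vector \<Rightarrow> 'e::euclidean_model"
  assumes "smooth_near f x" "smooth_near g (f x)"
  shows "smooth_near (\<lambda>x. g (f x)) x"
proof -
  obtain U V where U: "open U" "x \<in> U" "smooth_on U f" and V: "open V" "f x \<in> V" "smooth_on V g"
    using assms by (auto simp: smooth_near_def)
  have "Ck_on 0 U f" using U(3) unfolding smooth_on_def by blast
  then have "continuous_on U f" by simp
  then have o: "open (U \<inter> f -` V)"
    using U(1) V(1) by (simp add: continuous_open_preimage)
  have "Ck_on k (U \<inter> f -` V) (\<lambda>x. g (f x))" for k
  proof (rule Ck_on_compose[OF o V(1)])
    show "Ck_on k V g" using V(3) by (simp add: smooth_on_def)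
    show "Ck_on k (U \<inter> f -` V) f"
      by (rule Ck_on_subset[of k U f]) (use U(3) in \<open>simp_all add: smooth_on_def\<close>)
  qed auto
  then show ?thesis
    unfolding smooth_near_def smooth_on_def
    using o U(2) V(2) by (intro exI[of _ "U \<inter> f -` V"]) simp
qed

text \<open>
  The evaluation $(y, w) \mapsto Dh(y) w$ at a base point and a vector that both depend smoothly on
  a parameter; the varying $w$ is again expanded in an orthonormal basis. The coordinate expression of a pulled
  back system has exactly this form.
\<close>

lemma smooth_near_derivative_apply:
  fixes y :: "'c::real_normed_vector \<Rightarrow> 'd::euclidean_model"
  assumes "smooth_near y x" "smooth_near w x" "smooth_near h (y x)"
  shows "smooth_near (\<lambda>x. frechet_derivative h (at (y x)) (w x)) x"
proof -
  obtain B :: "'d set" where B: "orthonormal_basis B"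
    using ex_orthonormal_basis unfolding orthonormal_basis_def by auto
  \<comment> \<open>Linearity of \<open>Dh(y z)\<close> is available only where \<open>h\<close> is differentiable, hence near \<open>x\<close>.\<close>
  have "\<forall>\<^sub>F z in nhds x. h differentiable (at (y z))"
  proof -
    have "isCont y x"
      by (rule differentiable_imp_continuous_within[OF smooth_near_imp_differentiable[OF assms(1)]])
    then have "filterlim y (nhds (y x)) (nhds x)"
      unfolding isCont_def by (rule tendsto_at_iff_tendsto_nhds[THEN iffD1])
    then have "\<forall>\<^sub>F z in nhds x. smooth_near h (y z)"
      unfolding filterlim_iff using smooth_near_eventually[OF assms(3)] by blast
    then show ?thesis by (rule eventually_mono) (rule smooth_near_imp_differentiable)
  qed
  then have "\<forall>\<^sub>F z in nhds x. (\<Sum>u\<in>B. inner (w z) u *\<^sub>R frechet_derivative h (at (y z)) u) =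
      frechet_derivative h (at (y z)) (w z)"
    by (rule eventually_mono)
      (rule linear_orthonormal_expansion[OF B linear_frechet_derivative, symmetric])
  moreover have "smooth_near (\<lambda>z. \<Sum>u\<in>B. inner (w z) u *\<^sub>R frechet_derivative h (at (y z)) u) x"
  proof (rule smooth_near_sum)
    show "finite B" using B by (simp add: orthonormal_basis_def)
    show "smooth_near (\<lambda>z. inner (w z) u *\<^sub>R frechet_derivative h (at (y z)) u) x" for u
      by (rule smooth_near_scaleR[OF smooth_near_bounded_linear[OF bounded_linear_inner_left assms(2)]
        smooth_near_compose[OF assms(1) smooth_near_frechet_derivative[OF assms(3)]]])
  qed
  ultimately show ?thesis by (rule smooth_near_cong)
qed

section \<open>Functions that are smooth at a point of a manifold\<close>

lemma manifold_chart_domain_open: "manifold M \<Longrightarrow> \<kappa> \<in> atlas M \<Longrightarrow> openin (mtop M) (fst \<kappa>)"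
  by (simp add: manifold_def)

lemma charts_atD: "\<kappa> \<in> charts_at M x \<Longrightarrow> \<kappa> \<in> atlas M \<and> x \<in> fst \<kappa>"
  by (simp add: charts_at_def)

lemma charts_at_nonempty:
  assumes "manifold M" "x \<in> points M" shows "\<exists>\<kappa>. \<kappa> \<in> charts_at M x"
proof -
  have "x \<in> (\<Union>\<kappa>\<in>atlas M. fst \<kappa>)" using assms unfolding manifold_def by blast
  then show ?thesis unfolding charts_at_def by blast
qed

lemma chart_homeomorphic:
  assumes "manifold M" "\<kappa> \<in> atlas M"
  shows "homeomorphic_map (subtopology (mtop M) (fst \<kappa>)) (top_of_set (snd \<kappa> ` fst \<kappa>)) (snd \<kappa>)"
    and "topspace (subtopology (mtop M) (fst \<kappa>)) = fst \<kappa>"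
proof -
  show "homeomorphic_map (subtopology (mtop M) (fst \<kappa>)) (top_of_set (snd \<kappa> ` fst \<kappa>)) (snd \<kappa>)"
    using assms unfolding manifold_def by blast
  show "topspace (subtopology (mtop M) (fst \<kappa>)) = fst \<kappa>"
    using openin_subset[OF manifold_chart_domain_open[OF assms]] by auto
qed

lemma chart_inj:
  assumes "manifold M" "\<kappa> \<in> atlas M"
  shows "inj_on (snd \<kappa>) (fst \<kappa>)"
  using homeomorphic_imp_injective_map[OF chart_homeomorphic(1)[OF assms]]
    chart_homeomorphic(2)[OF assms] by simp

lemma chart_inv_chart:
  "manifold M \<Longrightarrow> \<kappa> \<in> atlas M \<Longrightarrow> x \<in> fst \<kappa> \<Longrightarrow> chart_inv \<kappa> (snd \<kappa> x) = x"
  unfolding chart_inv_def by (rule inv_into_f_f[OF chart_inj])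

lemma chart_image_open:
  assumes "manifold M" "\<kappa> \<in> atlas M" "openin (mtop M) U"
  shows "open (snd \<kappa> ` (fst \<kappa> \<inter> U))"
proof -
  have "openin (top_of_set (snd \<kappa> ` fst \<kappa>)) (snd \<kappa> ` (fst \<kappa> \<inter> U))"
    using homeomorphic_map_openness[OF chart_homeomorphic(1)[OF assms(1,2)], of "fst \<kappa> \<inter> U"]
      assms(3) openin_subtopology_Int2[of "mtop M" U "fst \<kappa>"]
    unfolding chart_homeomorphic(2)[OF assms(1,2)] by simp
  moreover have "open (snd \<kappa> ` fst \<kappa>)" using assms(1,2) by (simp add: manifold_def)
  ultimately show ?thesis using openin_open_trans by blast
qed

lemma chart_preimage_open:
  assumes "manifold M" "\<kappa> \<in> atlas M" "open W"
  shows "openin (mtop M) {x \<in> fst \<kappa>. snd \<kappa> x \<in> W}"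
proof -
  have "continuous_map (subtopology (mtop M) (fst \<kappa>)) (top_of_set (snd \<kappa> ` fst \<kappa>)) (snd \<kappa>)"
    by (rule homeomorphic_imp_continuous_map[OF chart_homeomorphic(1)[OF assms(1,2)]])
  then have "continuous_map (subtopology (mtop M) (fst \<kappa>)) euclidean (snd \<kappa>)"
    by (simp add: continuous_map_in_subtopology)
  from openin_continuous_map_preimage[OF this, of W]
  have "openin (subtopology (mtop M) (fst \<kappa>)) {x \<in> fst \<kappa>. snd \<kappa> x \<in> W}"
    using assms(3) unfolding chart_homeomorphic(2)[OF assms(1,2)] by simp
  then show ?thesis
    by (rule openin_trans_full[OF _ manifold_chart_domain_open[OF assms(1,2)]])
qed

text \<open>
  Turns a statement about the points of a neighbourhood of \<open>x\<close> into one about the coordinates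
  near those of \<open>x\<close>, so that identities between maps of manifolds become identities between germs
  of their coordinate expressions.
\<close>

lemma eventually_chart_inv:
  assumes "manifold M" "\<kappa> \<in> charts_at M x" "openin (mtop M) U" "x \<in> U"
    and "\<And>z. z \<in> fst \<kappa> \<Longrightarrow> z \<in> U \<Longrightarrow> P (snd \<kappa> z)"
  shows "\<forall>\<^sub>F y in nhds (snd \<kappa> x). P y"
  unfolding eventually_nhds
proof (intro exI conjI ballI)
  show "open (snd \<kappa> ` (fst \<kappa> \<inter> U))"
    using charts_atD[OF assms(2)] by (intro chart_image_open[OF assms(1) _ assms(3)]) simp
  show "snd \<kappa> x \<in> snd \<kappa> ` (fst \<kappa> \<inter> U)" using charts_atD[OF assms(2)] assms(4) by simp
  show "P y" if "y \<in> snd \<kappa> ` (fst \<kappa> \<inter> U)" for y using that assms(5) by auto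
qed

lemma transition_smooth_near:
  assumes "manifold M" "\<kappa> \<in> charts_at M x" "\<kappa>' \<in> charts_at M x"
  shows "smooth_near (\<lambda>y. snd \<kappa>' (chart_inv \<kappa> y)) (snd \<kappa> x)"
proof -
  note c = charts_atD[OF assms(2)] charts_atD[OF assms(3)]
  have "smooth_on (snd \<kappa> ` (fst \<kappa> \<inter> fst \<kappa>')) (snd \<kappa>' \<circ> chart_inv \<kappa>)"
    using assms(1) c unfolding manifold_def by blast
  moreover have "open (snd \<kappa> ` (fst \<kappa> \<inter> fst \<kappa>'))"
    using c by (intro chart_image_open[OF assms(1)] manifold_chart_domain_open[OF assms(1)]) simp_all
  ultimately show ?thesis using c by (simp add: smooth_on_iff_near o_def)
qed

text \<open>
  Functions with values in a vector space, for which smoothness at a point of the manifold can be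
  handled without charts on the target. All charts around \<open>x\<close> are quantified over; by the next
  lemma one suffices.
\<close>

definition smooth_fun_at ::
  "('m, 'd::real_normed_vector) mfd \<Rightarrow> ('m \<Rightarrow> 'v::real_normed_vector) \<Rightarrow> 'm \<Rightarrow> bool" where
  "smooth_fun_at M f x \<longleftrightarrow> (\<forall>\<kappa>\<in>charts_at M x. smooth_near (\<lambda>y. f (chart_inv \<kappa> y)) (snd \<kappa> x))"

text \<open>
  Two coordinate expressions differ by a transition map, which is smooth.
\<close>

lemma smooth_fun_atI:
  fixes M :: "('m, 'd::euclidean_model) mfd"
  assumes "manifold M" "\<kappa> \<in> charts_at M x" "smooth_near (\<lambda>y. f (chart_inv \<kappa> y)) (snd \<kappa> x)"
  shows "smooth_fun_at M f x"
  unfolding smooth_fun_at_def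
proof
  fix \<kappa>' assume \<kappa>': "\<kappa>' \<in> charts_at M x"
  note c = charts_atD[OF assms(2)] charts_atD[OF \<kappa>']
  have inv: "chart_inv \<kappa>' (snd \<kappa>' x) = x" using c by (simp add: chart_inv_chart[OF assms(1)])
  \<comment> \<open>Precompose the known coordinate expression with the transition map.\<close>
  have "smooth_near (\<lambda>y. f (chart_inv \<kappa> (snd \<kappa> (chart_inv \<kappa>' y)))) (snd \<kappa>' x)"
    using assms(3) inv
    by (intro smooth_near_compose[OF transition_smooth_near[OF assms(1) \<kappa>' assms(2)]]) simp
  moreover have "\<forall>\<^sub>F y in nhds (snd \<kappa>' x).
      f (chart_inv \<kappa> (snd \<kappa> (chart_inv \<kappa>' y))) = f (chart_inv \<kappa>' y)"
    by (rule eventually_chart_inv[OF assms(1) \<kappa>', of "fst \<kappa>"])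
      (use c in \<open>simp_all add: manifold_chart_domain_open[OF assms(1)] chart_inv_chart[OF assms(1)]\<close>)
  ultimately show "smooth_near (\<lambda>y. f (chart_inv \<kappa>' y)) (snd \<kappa>' x)"
    by (rule smooth_near_cong[rotated])
qed

lemma smooth_fun_at_cong:
  assumes "manifold M" "openin (mtop M) U" "x \<in> U" "\<And>y. y \<in> U \<Longrightarrow> f y = g y"
    and "smooth_fun_at M f x"
  shows "smooth_fun_at M g x"
  unfolding smooth_fun_at_def
proof
  fix \<kappa> assume \<kappa>: "\<kappa> \<in> charts_at M x"
  have "\<forall>\<^sub>F y in nhds (snd \<kappa> x). f (chart_inv \<kappa> y) = g (chart_inv \<kappa> y)"
    by (rule eventually_chart_inv[OF assms(1) \<kappa> assms(2,3)])
      (use assms(4) charts_atD[OF \<kappa>] in \<open>simp add: chart_inv_chart[OF assms(1)]\<close>)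
  then show "smooth_near (\<lambda>y. g (chart_inv \<kappa> y)) (snd \<kappa> x)"
    by (rule smooth_near_cong) (use assms(5) \<kappa> in \<open>simp add: smooth_fun_at_def\<close>)
qed

lemma smooth_fun_at_chart:
  "manifold M \<Longrightarrow> \<kappa> \<in> charts_at M x \<Longrightarrow> smooth_fun_at M (snd \<kappa>) x"
  unfolding smooth_fun_at_def by (simp add: transition_smooth_near)

lemma smooth_fun_at_const: "smooth_fun_at M (\<lambda>x. c) x"
  by (simp add: smooth_fun_at_def smooth_near_const)

lemma smooth_fun_at_add:
  "smooth_fun_at M f x \<Longrightarrow> smooth_fun_at M g x \<Longrightarrow> smooth_fun_at M (\<lambda>x. f x + g x) x"
  by (simp add: smooth_fun_at_def smooth_near_add)

lemma smooth_fun_at_bounded_linear: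
  "bounded_linear L \<Longrightarrow> smooth_fun_at M f x \<Longrightarrow> smooth_fun_at M (\<lambda>x. L (f x)) x"
  unfolding smooth_fun_at_def using smooth_near_bounded_linear[of L] by blast

lemma smooth_fun_at_Pair:
  "smooth_fun_at M f x \<Longrightarrow> smooth_fun_at M g x \<Longrightarrow> smooth_fun_at M (\<lambda>x. (f x, g x)) x"
  by (simp add: smooth_fun_at_def smooth_near_Pair)

lemma smooth_fun_at_derivative_apply:
  fixes y :: "'m \<Rightarrow> 'd::euclidean_model"
  assumes "manifold M" "smooth_fun_at M y x" "smooth_fun_at M w x" "smooth_near h (y x)"
  shows "smooth_fun_at M (\<lambda>x. frechet_derivative h (at (y x)) (w x)) x"
  unfolding smooth_fun_at_def
proof
  fix \<kappa> assume \<kappa>: "\<kappa> \<in> charts_at M x"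
  show "smooth_near (\<lambda>z. frechet_derivative h (at (y (chart_inv \<kappa> z))) (w (chart_inv \<kappa> z))) (snd \<kappa> x)"
    using assms(2-4) \<kappa> charts_atD[OF \<kappa>]
    by (intro smooth_near_derivative_apply) (simp_all add: smooth_fun_at_def chart_inv_chart[OF assms(1)])
qed

text \<open>
  Smooth functions are continuous. Stated through preimages because the topology of a manifold is
  not that of a type class.
\<close>

lemma smooth_fun_at_preimage_open:
  fixes M :: "('m, 'd::euclidean_model) mfd"
  assumes "manifold M" "openin (mtop M) U" "\<And>x. x \<in> U \<Longrightarrow> smooth_fun_at M f x" "open W"
  shows "openin (mtop M) {x \<in> U. f x \<in> W}"
proof (subst openin_subopen, intro ballI)
  fix x assume x: "x \<in> {x \<in> U. f x \<in> W}"
  then have xp: "x \<in> points M" using openin_subset[OF assms(2)] by auto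
  obtain \<kappa> where \<kappa>: "\<kappa> \<in> charts_at M x" using charts_at_nonempty[OF assms(1) xp] by blast
  note c = charts_atD[OF \<kappa>]
  have "smooth_near (\<lambda>y. f (chart_inv \<kappa> y)) (snd \<kappa> x)"
    using assms(3)[of x] x \<kappa> by (simp add: smooth_fun_at_def)
  then obtain V where V: "open V" "snd \<kappa> x \<in> V" "smooth_on V (\<lambda>y. f (chart_inv \<kappa> y))"
    unfolding smooth_near_def by blast
  have "Ck_on 0 V (\<lambda>y. f (chart_inv \<kappa> y))" using V(3) unfolding smooth_on_def by blast
  then have o: "open (V \<inter> (\<lambda>y. f (chart_inv \<kappa> y)) -` W)"
    using continuous_open_preimage[OF _ V(1) assms(4)] by simp
  let ?T = "{z \<in> fst \<kappa>. snd \<kappa> z \<in> V \<inter> (\<lambda>y. f (chart_inv \<kappa> y)) -` W} \<inter> U"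
  have "openin (mtop M) ?T"
    using c by (intro openin_Int[OF chart_preimage_open[OF assms(1) _ o] assms(2)]) simp
  moreover have "x \<in> ?T" using x c V(2) by (simp add: chart_inv_chart[OF assms(1)])
  moreover have "?T \<subseteq> {x \<in> U. f x \<in> W}"
    using c by (auto simp: chart_inv_chart[OF assms(1)])
  ultimately show "\<exists>T. openin (mtop M) T \<and> x \<in> T \<and> T \<subseteq> {x \<in> U. f x \<in> W}" by blast
qed

section \<open>Smooth maps\<close>

lemma smooth_mapD_cont: "smooth_map M N f \<Longrightarrow> continuous_map (mtop M) (mtop N) f"
  by (simp add: smooth_map_def)

lemma smooth_map_points: "smooth_map M N f \<Longrightarrow> x \<in> points M \<Longrightarrow> f x \<in> points N"
  using continuous_map_image_subset_topspace[OF smooth_mapD_cont] by blast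

text \<open>
  Of the target, only openness of the chart domains is assumed. This permits the tangent bundle as
  a target without showing first that it is a manifold.
\<close>

lemma smooth_map_iff:
  fixes M :: "('m, 'd::euclidean_model) mfd"
  assumes "manifold M" and N: "\<And>\<kappa>. \<kappa> \<in> atlas N \<Longrightarrow> openin (mtop N) (fst \<kappa>)"
  shows "smooth_map M N f \<longleftrightarrow> continuous_map (mtop M) (mtop N) f \<and>
    (\<forall>x\<in>points M. \<forall>\<kappa>'\<in>charts_at N (f x). smooth_fun_at M (\<lambda>z. snd \<kappa>' (f z)) x)"
proof (cases "continuous_map (mtop M) (mtop N) f")
  case cont: True
  have "smooth_on (snd \<kappa> ` (fst \<kappa> \<inter> f -` fst \<kappa>')) (snd \<kappa>' \<circ> f \<circ> chart_inv \<kappa>) \<longleftrightarrow>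
      (\<forall>x\<in>points M. x \<in> fst \<kappa> \<longrightarrow> f x \<in> fst \<kappa>' \<longrightarrow>
         smooth_near (\<lambda>y. snd \<kappa>' (f (chart_inv \<kappa> y))) (snd \<kappa> x))"
    if "\<kappa> \<in> atlas M" "\<kappa>' \<in> atlas N" for \<kappa> \<kappa>'
  proof -
    have sub: "fst \<kappa> \<subseteq> points M"
      by (rule openin_subset[OF manifold_chart_domain_open[OF assms(1) that(1)]])
    have "openin (mtop M) {x \<in> points M. f x \<in> fst \<kappa>'}"
      by (rule openin_continuous_map_preimage[OF cont N[OF that(2)]])
    moreover have "fst \<kappa> \<inter> {x \<in> points M. f x \<in> fst \<kappa>'} = fst \<kappa> \<inter> f -` fst \<kappa>'" using sub by auto
    ultimately have o: "open (snd \<kappa> ` (fst \<kappa> \<inter> f -` fst \<kappa>'))"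
      using chart_image_open[OF assms(1) that(1), of "{x \<in> points M. f x \<in> fst \<kappa>'}"] by simp
    show ?thesis
      unfolding smooth_on_iff_near[OF o]
      using sub by (auto simp: o_def chart_inv_chart[OF assms(1) that(1)])
  qed
  then have "smooth_map M N f \<longleftrightarrow> (\<forall>\<kappa>\<in>atlas M. \<forall>\<kappa>'\<in>atlas N. \<forall>x\<in>points M. x \<in> fst \<kappa> \<longrightarrow> f x \<in> fst \<kappa>' \<longrightarrow>
         smooth_near (\<lambda>y. snd \<kappa>' (f (chart_inv \<kappa> y))) (snd \<kappa> x))"
    using cont by (simp add: smooth_map_def)
  also have "\<dots> \<longleftrightarrow> (\<forall>x\<in>points M. \<forall>\<kappa>'\<in>charts_at N (f x). smooth_fun_at M (\<lambda>z. snd \<kappa>' (f z)) x)"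
    unfolding smooth_fun_at_def charts_at_def by blast
  finally show ?thesis using cont by simp
qed (simp add: smooth_map_def)

lemma smooth_map_chart:
  fixes M :: "('m, 'd::euclidean_model) mfd"
  assumes "manifold M" "manifold N" "smooth_map M N f" "x \<in> points M" "\<kappa>' \<in> charts_at N (f x)"
  shows "smooth_fun_at M (\<lambda>z. snd \<kappa>' (f z)) x"
  using smooth_map_iff[OF assms(1) manifold_chart_domain_open[OF assms(2)]] assms(3-5) by blast

text \<open>
  Near \<open>x\<close> the composite factors through the coordinates of any chart around \<open>f x\<close>, so the
  chain rule for germs applies.
\<close>

lemma smooth_fun_at_compose:
  fixes M :: "('m, 'd::euclidean_model) mfd" and N :: "('n, 'e::euclidean_model) mfd"
  assumes "manifold M" "manifold N" "smooth_map M N f" "x \<in> points M" "smooth_fun_at N g (f x)"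
  shows "smooth_fun_at M (\<lambda>z. g (f z)) x"
proof -
  obtain \<kappa> where \<kappa>: "\<kappa> \<in> charts_at M x" using charts_at_nonempty[OF assms(1,4)] by blast
  obtain \<kappa>' where \<kappa>': "\<kappa>' \<in> charts_at N (f x)"
    using charts_at_nonempty[OF assms(2) smooth_map_points[OF assms(3,4)]] by blast
  note c = charts_atD[OF \<kappa>] charts_atD[OF \<kappa>']
  have inv: "chart_inv \<kappa> (snd \<kappa> x) = x" using c by (simp add: chart_inv_chart[OF assms(1)])
  have "smooth_near (\<lambda>y. snd \<kappa>' (f (chart_inv \<kappa> y))) (snd \<kappa> x)"
    using smooth_map_chart[OF assms(1-4) \<kappa>'] \<kappa> by (simp add: smooth_fun_at_def)
  then have "smooth_near (\<lambda>y. g (chart_inv \<kappa>' (snd \<kappa>' (f (chart_inv \<kappa> y))))) (snd \<kappa> x)"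
    by (rule smooth_near_compose) (use assms(5) \<kappa>' inv in \<open>simp add: smooth_fun_at_def\<close>)
  then have *: "smooth_fun_at M (\<lambda>z. g (chart_inv \<kappa>' (snd \<kappa>' (f z)))) x"
    by (rule smooth_fun_atI[OF assms(1) \<kappa>])
  have "openin (mtop M) {z \<in> points M. f z \<in> fst \<kappa>'}"
    using c by (intro openin_continuous_map_preimage[OF smooth_mapD_cont[OF assms(3)]]
        manifold_chart_domain_open[OF assms(2)]) simp
  then show ?thesis
    by (rule smooth_fun_at_cong[OF assms(1) _ _ _ *])
      (use assms(4) c in \<open>simp_all add: chart_inv_chart[OF assms(2)]\<close>)
qed

lemma smooth_map_compose:
  fixes M :: "('m, 'd::euclidean_model) mfd" and N :: "('n, 'e::euclidean_model) mfd"
    and P :: "('p, 'f::euclidean_model) mfd"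
  assumes "manifold M" "manifold N" "manifold P" "smooth_map M N f" "smooth_map N P g"
  shows "smooth_map M P (\<lambda>x. g (f x))"
proof -
  have "continuous_map (mtop M) (mtop P) (\<lambda>x. g (f x))"
    using continuous_map_compose[OF smooth_mapD_cont[OF assms(4)] smooth_mapD_cont[OF assms(5)]]
    by (simp add: o_def)
  moreover have "smooth_fun_at M (\<lambda>z. snd \<kappa> (g (f z))) x"
    if "x \<in> points M" "\<kappa> \<in> charts_at P (g (f x))" for x \<kappa>
    by (rule smooth_fun_at_compose[OF assms(1,2,4) that(1)])
      (rule smooth_map_chart[OF assms(2,3,5) smooth_map_points[OF assms(4) that(1)] that(2)])
  ultimately show ?thesis
    using smooth_map_iff[OF assms(1) manifold_chart_domain_open[OF assms(3)]] by blast
qed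

section \<open>The tangent map\<close>

lemma smooth_map_local_rep:
  fixes M :: "('m, 'd::euclidean_model) mfd"
  assumes "manifold M" "manifold N" "smooth_map M N f" "x \<in> points M"
    "\<kappa> \<in> charts_at M x" "\<kappa>' \<in> charts_at N (f x)"
  shows "smooth_near (\<lambda>y. snd \<kappa>' (f (chart_inv \<kappa> y))) (snd \<kappa> x)"
  using smooth_map_chart[OF assms(1-4,6)] assms(5) by (simp add: smooth_fun_at_def)

text \<open>
  The differential of \<open>f\<close> at \<open>x\<close> in the charts \<open>\<kappa>\<close> and \<open>\<kappa>'\<close>. For the identity map it is the
  transition rule that defines tangent vectors.
\<close>

abbreviation local_derivative ::
  "('m, 'd::real_normed_vector) chart \<Rightarrow> ('n, 'e::real_normed_vector) chart \<Rightarrow> ('m \<Rightarrow> 'n) \<Rightarrow> 'm \<Rightarrow> 'd \<Rightarrow> 'e" where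
  "local_derivative \<kappa> \<kappa>' f x \<equiv> frechet_derivative (\<lambda>y. snd \<kappa>' (f (chart_inv \<kappa> y))) (at (snd \<kappa> x))"

text \<open>
  The chain rule in charts. Its instances with one of the maps the identity are what makes
  tangent maps well defined and tangent-valued.
\<close>

lemma local_derivative_compose:
  fixes M :: "('m, 'd::euclidean_model) mfd" and N :: "('n, 'e::euclidean_model) mfd"
    and P :: "('p, 'f::euclidean_model) mfd"
  assumes "manifold M" "manifold N" "manifold P" "smooth_map M N f" "smooth_map N P g"
    and x: "x \<in> points M" and \<kappa>: "\<kappa> \<in> charts_at M x" and \<kappa>': "\<kappa>' \<in> charts_at N (f x)"
    and \<kappa>'': "\<kappa>'' \<in> charts_at P (g (f x))"
  shows "local_derivative \<kappa>' \<kappa>'' g (f x) (local_derivative \<kappa> \<kappa>' f x v) =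
    local_derivative \<kappa> \<kappa>'' (\<lambda>x. g (f x)) x v"
proof -
  note c = charts_atD[OF \<kappa>] charts_atD[OF \<kappa>'] charts_atD[OF \<kappa>'']
  have inv: "chart_inv \<kappa> (snd \<kappa> x) = x" using c by (simp add: chart_inv_chart[OF assms(1)])
  have fx: "f x \<in> points N" by (rule smooth_map_points[OF assms(4) x])
  have d: "(\<lambda>y. snd \<kappa>' (f (chart_inv \<kappa> y))) differentiable (at (snd \<kappa> x))"
    "(\<lambda>y. snd \<kappa>'' (g (chart_inv \<kappa>' y))) differentiable (at (snd \<kappa>' (f (chart_inv \<kappa> (snd \<kappa> x)))))"
    unfolding inv
    by (intro smooth_near_imp_differentiable smooth_map_local_rep[OF assms(1,2,4) x \<kappa> \<kappa>']
        smooth_map_local_rep[OF assms(2,3,5) fx \<kappa>' \<kappa>''])+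
  have "local_derivative \<kappa>' \<kappa>'' g (f x) (local_derivative \<kappa> \<kappa>' f x v) =
      frechet_derivative (\<lambda>y. snd \<kappa>'' (g (chart_inv \<kappa>' (snd \<kappa>' (f (chart_inv \<kappa> y)))))) (at (snd \<kappa> x)) v"
    by (rule frechet_derivative_chain[OF d, unfolded inv, symmetric])
  also have "\<dots> = local_derivative \<kappa> \<kappa>'' (\<lambda>x. g (f x)) x v"
  proof (rule fun_cong[OF frechet_derivative_cong])
    have "openin (mtop M) {z \<in> points M. f z \<in> fst \<kappa>'}"
      using c by (intro openin_continuous_map_preimage[OF smooth_mapD_cont[OF assms(4)]]
          manifold_chart_domain_open[OF assms(2)]) simp
    then show "\<forall>\<^sub>F y in nhds (snd \<kappa> x).
        snd \<kappa>'' (g (chart_inv \<kappa>' (snd \<kappa>' (f (chart_inv \<kappa> y))))) = snd \<kappa>'' (g (f (chart_inv \<kappa> y)))"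
      by (rule eventually_chart_inv[OF assms(1) \<kappa>])
        (use x c in \<open>simp_all add: chart_inv_chart[OF assms(1)] chart_inv_chart[OF assms(2)]\<close>)
  qed
  finally show ?thesis .
qed

lemma smooth_map_ident:
  fixes M :: "('m, 'd::euclidean_model) mfd"
  assumes "manifold M" shows "smooth_map M M (\<lambda>x. x)"
  by (rule smooth_map_iff[OF assms manifold_chart_domain_open[OF assms], THEN iffD2])
    (simp_all add: smooth_fun_at_chart[OF assms])

lemma tangent_spaceD:
  "v \<in> tangent_space M x \<Longrightarrow> \<kappa> \<in> charts_at M x \<Longrightarrow> \<kappa>' \<in> charts_at M x \<Longrightarrow>
    v \<kappa>' = local_derivative \<kappa> \<kappa>' (\<lambda>x. x) x (v \<kappa>)"
  unfolding tangent_space_def o_def by blast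

lemma tangent_space_off_charts: "v \<in> tangent_space M x \<Longrightarrow> \<kappa> \<notin> charts_at M x \<Longrightarrow> v \<kappa> = 0"
  unfolding tangent_space_def by blast

lemma tangent_spaceI:
  assumes "\<And>\<kappa>. \<kappa> \<notin> charts_at M x \<Longrightarrow> v \<kappa> = 0"
    and "\<And>\<kappa> \<kappa>'. \<kappa> \<in> charts_at M x \<Longrightarrow> \<kappa>' \<in> charts_at M x \<Longrightarrow>
      v \<kappa>' = local_derivative \<kappa> \<kappa>' (\<lambda>x. x) x (v \<kappa>)"
  shows "v \<in> tangent_space M x"
  using assms unfolding tangent_space_def o_def by blast

lemma fst_tangent_map [simp]: "fst (tangent_map M N f w) = f (fst w)"
  by (simp add: tangent_map_def split: prod.split)

text \<open>
  The tangent map is defined through an arbitrarily chosen chart at \<open>x\<close>; since \<open>v\<close> transforms by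
  the derivative of the coordinate change, the chain rule shows that any other chart gives the same
  value.
\<close>

lemma tangent_map_coord:
  fixes M :: "('m, 'd::euclidean_model) mfd" and N :: "('n, 'e::euclidean_model) mfd"
  assumes "manifold M" "manifold N" "smooth_map M N f" "x \<in> points M" "v \<in> tangent_space M x"
    and \<kappa>: "\<kappa> \<in> charts_at M x" and \<kappa>': "\<kappa>' \<in> charts_at N (f x)"
  shows "snd (tangent_map M N f (x, v)) \<kappa>' = local_derivative \<kappa> \<kappa>' f x (v \<kappa>)"
proof -
  define \<kappa>0 where "\<kappa>0 = (SOME \<kappa>. \<kappa> \<in> charts_at M x)"
  have \<kappa>0: "\<kappa>0 \<in> charts_at M x" unfolding \<kappa>0_def by (rule someI[of "\<lambda>\<kappa>. \<kappa> \<in> charts_at M x", OF \<kappa>])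
  have "snd (tangent_map M N f (x, v)) \<kappa>' = local_derivative \<kappa>0 \<kappa>' f x (v \<kappa>0)"
    using \<kappa>' by (simp add: tangent_map_def \<kappa>0_def Let_def o_def)
  also have "\<dots> = local_derivative \<kappa> \<kappa>' f x (local_derivative \<kappa>0 \<kappa> (\<lambda>x. x) x (v \<kappa>0))"
    by (rule local_derivative_compose[OF assms(1,1,2) smooth_map_ident[OF assms(1)] assms(3,4) \<kappa>0 \<kappa> \<kappa>',
          symmetric])
  also have "\<dots> = local_derivative \<kappa> \<kappa>' f x (v \<kappa>)"
    by (simp only: tangent_spaceD[OF assms(5) \<kappa>0 \<kappa>])
  finally show ?thesis .
qed

lemma tangent_map_off_charts:
  "\<kappa>' \<notin> charts_at N (f x) \<Longrightarrow> snd (tangent_map M N f (x, v)) \<kappa>' = 0"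
  by (simp add: tangent_map_def)

text \<open>
  The chain rule for \<open>f\<close> followed by the identity of the target.
\<close>

lemma tangent_map_in:
  fixes M :: "('m, 'd::euclidean_model) mfd" and N :: "('n, 'e::euclidean_model) mfd"
  assumes "manifold M" "manifold N" "smooth_map M N f" "x \<in> points M" "v \<in> tangent_space M x"
  shows "snd (tangent_map M N f (x, v)) \<in> tangent_space N (f x)"
proof (rule tangent_spaceI)
  obtain \<kappa>0 where \<kappa>0: "\<kappa>0 \<in> charts_at M x" using charts_at_nonempty[OF assms(1,4)] by blast
  fix \<kappa> \<kappa>' assume \<kappa>: "\<kappa> \<in> charts_at N (f x)" "\<kappa>' \<in> charts_at N (f x)"
  show "snd (tangent_map M N f (x, v)) \<kappa>' =
      local_derivative \<kappa> \<kappa>' (\<lambda>x. x) (f x) (snd (tangent_map M N f (x, v)) \<kappa>)"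
    unfolding tangent_map_coord[OF assms \<kappa>0 \<kappa>(1)] tangent_map_coord[OF assms \<kappa>0 \<kappa>(2)]
    by (rule local_derivative_compose[OF assms(1,2,2,3) smooth_map_ident[OF assms(2)] assms(4) \<kappa>0 \<kappa>,
          symmetric])
qed (rule tangent_map_off_charts)

text \<open>
  Functoriality: compute both tangent maps in a fixed chart around \<open>f x\<close> and use the chain rule
  there.
\<close>

lemma tangent_map_compose:
  fixes M :: "('m, 'd::euclidean_model) mfd" and N :: "('n, 'e::euclidean_model) mfd"
    and P :: "('p, 'f::euclidean_model) mfd"
  assumes "manifold M" "manifold N" "manifold P" "smooth_map M N f" "smooth_map N P g"
    and "x \<in> points M" "v \<in> tangent_space M x"
  shows "tangent_map N P g (tangent_map M N f (x, v)) = tangent_map M P (\<lambda>x. g (f x)) (x, v)"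
proof -
  have fx: "f x \<in> points N" by (rule smooth_map_points[OF assms(4,6)])
  define w where "w = snd (tangent_map M N f (x, v))"
  have w: "tangent_map M N f (x, v) = (f x, w)" by (simp add: w_def prod_eq_iff)
  have wT: "w \<in> tangent_space N (f x)"
    unfolding w_def by (rule tangent_map_in[OF assms(1,2,4,6,7)])
  obtain \<kappa> where \<kappa>: "\<kappa> \<in> charts_at M x" using charts_at_nonempty[OF assms(1,6)] by blast
  obtain \<kappa>' where \<kappa>': "\<kappa>' \<in> charts_at N (f x)" using charts_at_nonempty[OF assms(2) fx] by blast
  have "snd (tangent_map N P g (f x, w)) \<kappa>'' = snd (tangent_map M P (\<lambda>x. g (f x)) (x, v)) \<kappa>''" for \<kappa>''
  proof (cases "\<kappa>'' \<in> charts_at P (g (f x))")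
    case True
    have "snd (tangent_map N P g (f x, w)) \<kappa>'' = local_derivative \<kappa>' \<kappa>'' g (f x) (w \<kappa>')"
      by (rule tangent_map_coord[OF assms(2,3,5) fx wT \<kappa>' True])
    also have "w \<kappa>' = local_derivative \<kappa> \<kappa>' f x (v \<kappa>)"
      unfolding w_def by (rule tangent_map_coord[OF assms(1,2,4,6,7) \<kappa> \<kappa>'])
    also have "local_derivative \<kappa>' \<kappa>'' g (f x) \<dots> = local_derivative \<kappa> \<kappa>'' (\<lambda>x. g (f x)) x (v \<kappa>)"
      by (rule local_derivative_compose[OF assms(1-6) \<kappa> \<kappa>' True])
    also have "\<dots> = snd (tangent_map M P (\<lambda>x. g (f x)) (x, v)) \<kappa>''"
      by (rule tangent_map_coord[OF assms(1,3) smooth_map_compose[OF assms(1-5)] assms(6,7) \<kappa> True,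
            symmetric])
    finally show ?thesis .
  next
    case False
    then show ?thesis by (simp add: tangent_map_off_charts)
  qed
  then show ?thesis unfolding w by (simp add: prod_eq_iff fun_eq_iff)
qed

text \<open>
  Charts have their domains inside the manifold, so values of the maps elsewhere do not affect the
  derivative. Hence the commuting square of the theorem, which holds on points only, passes to
  tangent maps.
\<close>

lemma tangent_map_cong:
  fixes M :: "('m, 'd::euclidean_model) mfd" and N :: "('n, 'e::real_normed_vector) mfd"
  assumes "manifold M" "\<forall>y\<in>points M. f y = g y" "x \<in> points M"
  shows "tangent_map M N f (x, v) = tangent_map M N g (x, v)"
proof -
  define \<kappa> where "\<kappa> = (SOME \<kappa>. \<kappa> \<in> charts_at M x)"
  have \<kappa>: "\<kappa> \<in> charts_at M x"
    unfolding \<kappa>_def using charts_at_nonempty[OF assms(1,3)] by (rule someI_ex)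
  have eq: "local_derivative \<kappa> \<kappa>' f x = local_derivative \<kappa> \<kappa>' g x" for \<kappa>' :: "('n, 'e) chart"
    by (rule frechet_derivative_cong, rule eventually_chart_inv[OF assms(1) \<kappa> openin_topspace assms(3)])
      (use charts_atD[OF \<kappa>] assms(2) in \<open>simp add: chart_inv_chart[OF assms(1)]\<close>)
  have "snd (tangent_map M N f (x, v)) \<kappa>' = snd (tangent_map M N g (x, v)) \<kappa>'" for \<kappa>'
    using assms(2,3)
    by (cases "\<kappa>' \<in> charts_at N (g x)")
      (simp_all add: tangent_map_def Let_def o_def eq flip: \<kappa>_def)
  then show ?thesis using assms(2,3) by (simp add: prod_eq_iff fun_eq_iff)
qed

lemma tangent_map_ident:
  fixes M :: "('m, 'd::euclidean_model) mfd"
  assumes "manifold M" "x \<in> points M" "v \<in> tangent_space M x"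
  shows "tangent_map M M (\<lambda>x. x) (x, v) = (x, v)"
proof -
  obtain \<kappa> where \<kappa>: "\<kappa> \<in> charts_at M x" using charts_at_nonempty[OF assms(1,2)] by blast
  have "snd (tangent_map M M (\<lambda>x. x) (x, v)) \<kappa>' = v \<kappa>'" for \<kappa>'
  proof (cases "\<kappa>' \<in> charts_at M x")
    case True
    show ?thesis
      using tangent_map_coord[OF assms(1,1) smooth_map_ident[OF assms(1)] assms(2,3) \<kappa> True]
        tangent_spaceD[OF assms(3) \<kappa> True] by simp
  qed (simp add: tangent_map_off_charts tangent_space_off_charts[OF assms(3)])
  then show ?thesis by (simp add: prod_eq_iff fun_eq_iff)
qed

lemma linear_local_derivative:
  fixes M :: "('m, 'd::euclidean_model) mfd"
  assumes "manifold M" "manifold N" "smooth_map M N f" "x \<in> points M"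
    "\<kappa> \<in> charts_at M x" "\<kappa>' \<in> charts_at N (f x)"
  shows "linear (local_derivative \<kappa> \<kappa>' f x)"
  by (intro linear_frechet_derivative smooth_near_imp_differentiable smooth_map_local_rep[OF assms])

lemma charts_at_points: "manifold M \<Longrightarrow> \<kappa> \<in> charts_at M x \<Longrightarrow> x \<in> points M"
  using openin_subset[OF manifold_chart_domain_open[of M \<kappa>]] by (auto simp: charts_at_def)

lemma tangent_space_zero:
  fixes M :: "('m, 'd::euclidean_model) mfd"
  assumes "manifold M"
  shows "(\<lambda>\<kappa>. 0) \<in> tangent_space M x"
proof (rule tangent_spaceI)
  fix \<kappa> \<kappa>' assume \<kappa>: "\<kappa> \<in> charts_at M x" "\<kappa>' \<in> charts_at M x"
  show "0 = local_derivative \<kappa> \<kappa>' (\<lambda>x. x) x 0"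
    by (rule linear_0[OF linear_local_derivative[OF assms assms smooth_map_ident[OF assms]
          charts_at_points[OF assms \<kappa>(1)] \<kappa>], symmetric])
qed simp

text \<open>
  The transition rule is linear in the vector. A single lemma on $r v + s w$ serves for addition,
  scaling and negation.
\<close>

lemma tangent_space_combination:
  fixes M :: "('m, 'd::euclidean_model) mfd"
  assumes "manifold M" "v \<in> tangent_space M x" "w \<in> tangent_space M x"
  shows "(\<lambda>\<kappa>. r *\<^sub>R v \<kappa> + s *\<^sub>R w \<kappa>) \<in> tangent_space M x"
proof (rule tangent_spaceI)
  fix \<kappa> \<kappa>' assume \<kappa>: "\<kappa> \<in> charts_at M x" "\<kappa>' \<in> charts_at M x"
  have L: "linear (local_derivative \<kappa> \<kappa>' (\<lambda>x. x) x)"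
    by (rule linear_local_derivative[OF assms(1,1) smooth_map_ident[OF assms(1)]
          charts_at_points[OF assms(1) \<kappa>(1)] \<kappa>])
  show "r *\<^sub>R v \<kappa>' + s *\<^sub>R w \<kappa>' = local_derivative \<kappa> \<kappa>' (\<lambda>x. x) x (r *\<^sub>R v \<kappa> + s *\<^sub>R w \<kappa>)"
    unfolding linear_add[OF L] linear_scale[OF L]
    by (simp flip: tangent_spaceD[OF assms(2) \<kappa>] tangent_spaceD[OF assms(3) \<kappa>])
qed (simp add: tangent_space_off_charts[OF assms(2)] tangent_space_off_charts[OF assms(3)])

lemma tangent_map_combination:
  fixes M :: "('m, 'd::euclidean_model) mfd" and N :: "('n, 'e::euclidean_model) mfd"
  assumes "manifold M" "manifold N" "smooth_map M N f" "x \<in> points M"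
    "v \<in> tangent_space M x" "w \<in> tangent_space M x"
  shows "tangent_map M N f (x, \<lambda>\<kappa>. r *\<^sub>R v \<kappa> + s *\<^sub>R w \<kappa>) =
    (f x, \<lambda>\<kappa>. r *\<^sub>R snd (tangent_map M N f (x, v)) \<kappa> + s *\<^sub>R snd (tangent_map M N f (x, w)) \<kappa>)"
proof -
  obtain \<kappa> where \<kappa>: "\<kappa> \<in> charts_at M x" using charts_at_nonempty[OF assms(1,4)] by blast
  have "snd (tangent_map M N f (x, \<lambda>\<kappa>. r *\<^sub>R v \<kappa> + s *\<^sub>R w \<kappa>)) \<kappa>' =
      r *\<^sub>R snd (tangent_map M N f (x, v)) \<kappa>' + s *\<^sub>R snd (tangent_map M N f (x, w)) \<kappa>'" for \<kappa>'
  proof (cases "\<kappa>' \<in> charts_at N (f x)")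
    case True
    note L = linear_local_derivative[OF assms(1-4) \<kappa> True]
    show ?thesis
      unfolding tangent_map_coord[OF assms(1-5) \<kappa> True] tangent_map_coord[OF assms(1-4,6) \<kappa> True]
        tangent_map_coord[OF assms(1-4) tangent_space_combination[OF assms(1,5,6)] \<kappa> True]
        linear_add[OF L] linear_scale[OF L] ..
  qed (simp add: tangent_map_off_charts)
  then show ?thesis by (simp add: prod_eq_iff fun_eq_iff)
qed

lemma tangent_map_zero:
  fixes M :: "('m, 'd::euclidean_model) mfd" and N :: "('n, 'e::euclidean_model) mfd"
  assumes "manifold M" "manifold N" "smooth_map M N f" "x \<in> points M"
  shows "tangent_map M N f (x, \<lambda>\<kappa>. 0) = (f x, \<lambda>\<kappa>. 0)"
  using tangent_map_combination[OF assms tangent_space_zero[OF assms(1)] tangent_space_zero[OF assms(1)],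
    of 0 0] by simp

section \<open>Smooth sections of the tangent bundle along a map\<close>

lemma fst_tangent_chart: "fst (tangent_chart N \<kappa>) = Sigma (fst \<kappa>) (tangent_space N)"
  and snd_tangent_chart: "snd (tangent_chart N \<kappa>) w = (snd \<kappa> (fst w), snd w \<kappa>)"
  by (simp_all add: tangent_chart_def split: prod.split)

text \<open>
  The domain of a tangent chart is the generator of the topology with \<open>W\<close> the whole space.
\<close>

lemma tangent_chart_domain_open:
  assumes "\<kappa>' \<in> atlas (tangent_bundle N)"
  shows "openin (mtop (tangent_bundle N)) (fst \<kappa>')"
proof -
  obtain \<kappa> where \<kappa>: "\<kappa> \<in> atlas N" "\<kappa>' = tangent_chart N \<kappa>"
    using assms by (auto simp: tangent_bundle_def)
  have "\<exists>\<kappa>1 W. fst \<kappa>' = fst (tangent_chart N \<kappa>1) \<inter> snd (tangent_chart N \<kappa>1) -` W \<and>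
      \<kappa>1 \<in> atlas N \<and> open W"
    using \<kappa> by (intro exI[of _ \<kappa>] exI[of _ UNIV]) simp
  then show ?thesis
    unfolding tangent_bundle_def mfd.simps by (intro topology_generated_by_Basis) blast
qed

lemma points_tangent_bundle:
  assumes "manifold N"
  shows "points (tangent_bundle N) = Sigma (points N) (tangent_space N)"
proof -
  let ?\<U> = "{fst (tangent_chart N \<kappa>) \<inter> snd (tangent_chart N \<kappa>) -` W | \<kappa> W. \<kappa> \<in> atlas N \<and> open W}"
  have "\<Union> ?\<U> = (\<Union>\<kappa>\<in>atlas N. fst (tangent_chart N \<kappa>))"
  proof
    show "(\<Union>\<kappa>\<in>atlas N. fst (tangent_chart N \<kappa>)) \<subseteq> \<Union> ?\<U>"
    proof (rule UN_least)
      fix \<kappa> assume "\<kappa> \<in> atlas N"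
      then have "fst (tangent_chart N \<kappa>) \<inter> snd (tangent_chart N \<kappa>) -` UNIV \<in> ?\<U>"
        using open_UNIV by blast
      then have "fst (tangent_chart N \<kappa>) \<inter> snd (tangent_chart N \<kappa>) -` UNIV \<subseteq> \<Union> ?\<U>"
        by (rule Union_upper)
      then show "fst (tangent_chart N \<kappa>) \<subseteq> \<Union> ?\<U>" by simp
    qed
  qed blast
  then have "points (tangent_bundle N) = (\<Union>\<kappa>\<in>atlas N. Sigma (fst \<kappa>) (tangent_space N))"
    unfolding tangent_bundle_def mfd.simps topology_generated_by_topspace fst_tangent_chart .
  also have "\<dots> = Sigma (\<Union>\<kappa>\<in>atlas N. fst \<kappa>) (tangent_space N)" by blast
  also have "(\<Union>\<kappa>\<in>atlas N. fst \<kappa>) = points N" using assms unfolding manifold_def by blast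
  finally show ?thesis .
qed

lemma charts_at_tangent_bundle:
  assumes "v \<in> tangent_space N y"
  shows "charts_at (tangent_bundle N) (y, v) = tangent_chart N ` charts_at N y"
  using assms unfolding charts_at_def tangent_bundle_def mfd.simps
  by (auto simp: fst_tangent_chart)

text \<open>
  In a tangent chart \<open>F\<close> reads $z \mapsto (\kappa(p(z)), v_\kappa(z))$, and the first component is
  smooth already because \<open>p\<close> is. Continuity into the tangent bundle is checked on the generators of
  its topology, whose preimages are open because smooth functions are continuous.
\<close>

lemma smooth_section_iff:
  fixes M :: "('m, 'd::euclidean_model) mfd" and N :: "('n, 'e::euclidean_model) mfd"
  assumes M: "manifold M" and N: "manifold N" and p: "smooth_map M N p"
    and F: "\<And>q. q \<in> points M \<Longrightarrow> F q \<in> {p q} \<times> tangent_space N (p q)"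
  shows "smooth_map M (tangent_bundle N) F \<longleftrightarrow>
    (\<forall>q\<in>points M. \<forall>\<kappa>\<in>charts_at N (p q). smooth_fun_at M (\<lambda>z. snd (F z) \<kappa>) q)"
proof -
  have charts: "charts_at (tangent_bundle N) (F q) = tangent_chart N ` charts_at N (p q)"
    if "q \<in> points M" for q
    using F[OF that] charts_at_tangent_bundle by fastforce
  have coord: "smooth_fun_at M (\<lambda>z. snd (tangent_chart N \<kappa>) (F z)) q \<longleftrightarrow>
      smooth_fun_at M (\<lambda>z. snd (F z) \<kappa>) q" if q: "q \<in> points M" and \<kappa>: "\<kappa> \<in> charts_at N (p q)" for q \<kappa>
  proof
    assume "smooth_fun_at M (\<lambda>z. snd (tangent_chart N \<kappa>) (F z)) q"
    from smooth_fun_at_bounded_linear[OF bounded_linear_snd this]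
    show "smooth_fun_at M (\<lambda>z. snd (F z) \<kappa>) q" by (simp add: snd_tangent_chart)
  next
    assume "smooth_fun_at M (\<lambda>z. snd (F z) \<kappa>) q"
    from smooth_fun_at_Pair[OF smooth_map_chart[OF M N p q \<kappa>] this]
    show "smooth_fun_at M (\<lambda>z. snd (tangent_chart N \<kappa>) (F z)) q"
      by (rule smooth_fun_at_cong[OF M openin_topspace q, rotated])
        (use F in \<open>force simp: snd_tangent_chart\<close>)
  qed
  have "continuous_map (mtop M) (mtop (tangent_bundle N)) F"
    if sm: "\<forall>q\<in>points M. \<forall>\<kappa>\<in>charts_at N (p q). smooth_fun_at M (\<lambda>z. snd (F z) \<kappa>) q"
    unfolding tangent_bundle_def mfd.simps
  proof (rule continuous_on_generated_topo)
    fix G assume "G \<in> {fst (tangent_chart N \<kappa>) \<inter> snd (tangent_chart N \<kappa>) -` W |\<kappa> W. \<kappa> \<in> atlas N \<and> open W}"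
    then obtain \<kappa> W where G: "G = fst (tangent_chart N \<kappa>) \<inter> snd (tangent_chart N \<kappa>) -` W"
      and \<kappa>: "\<kappa> \<in> atlas N" and W: "open W" by blast
    let ?U = "{q \<in> points M. p q \<in> fst \<kappa>}"
    have U: "openin (mtop M) ?U"
      by (rule openin_continuous_map_preimage[OF smooth_mapD_cont[OF p] manifold_chart_domain_open[OF N \<kappa>]])
    have "smooth_fun_at M (\<lambda>z. snd (tangent_chart N \<kappa>) (F z)) q" if "q \<in> ?U" for q
    proof -
      have "q \<in> points M" "\<kappa> \<in> charts_at N (p q)" using that \<kappa> by (simp_all add: charts_at_def)
      then show ?thesis using coord sm by blast
    qed
    from smooth_fun_at_preimage_open[OF M U this W]
    have "openin (mtop M) {q \<in> ?U. snd (tangent_chart N \<kappa>) (F q) \<in> W}" .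
    moreover have "F -` G \<inter> points M = {q \<in> ?U. snd (tangent_chart N \<kappa>) (F q) \<in> W}"
      unfolding G using F by (fastforce simp: fst_tangent_chart)
    ultimately show "openin (mtop M) (F -` G \<inter> points M)" by simp
  next
    have "F ` points M \<subseteq> points (tangent_bundle N)"
      using F smooth_map_points[OF p] by (fastforce simp: points_tangent_bundle[OF N])
    then show "F ` points M \<subseteq> \<Union> {fst (tangent_chart N \<kappa>) \<inter> snd (tangent_chart N \<kappa>) -` W |\<kappa> W.
        \<kappa> \<in> atlas N \<and> open W}"
      by (simp add: tangent_bundle_def topology_generated_by_topspace)
  qed
  moreover have "smooth_map M (tangent_bundle N) F \<longleftrightarrow> continuous_map (mtop M) (mtop (tangent_bundle N)) F \<and>
      (\<forall>q\<in>points M. \<forall>\<kappa>\<in>charts_at (tangent_bundle N) (F q). smooth_fun_at M (\<lambda>z. snd \<kappa> (F z)) q)"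
    by (rule smooth_map_iff[OF M tangent_chart_domain_open])
  moreover have "(\<forall>q\<in>points M. \<forall>\<kappa>\<in>charts_at (tangent_bundle N) (F q). smooth_fun_at M (\<lambda>z. snd \<kappa> (F z)) q) \<longleftrightarrow>
      (\<forall>q\<in>points M. \<forall>\<kappa>\<in>charts_at N (p q). smooth_fun_at M (\<lambda>z. snd (F z) \<kappa>) q)"
    by (simp only: charts coord ball_simps cong: ball_cong)
  ultimately show ?thesis by blast
qed

section \<open>The vector space of open systems\<close>

lemma surj_submersionD:
  assumes "surj_submersion a"
  shows "manifold (sub_tot a)" "manifold (sub_st a)" "smooth_map (sub_tot a) (sub_st a) (sub_proj a)"
  using assms by (simp_all add: surj_submersion_def)

lemma sub_proj_points:
  "surj_submersion a \<Longrightarrow> q \<in> points (sub_tot a) \<Longrightarrow> sub_proj a q \<in> points (sub_st a)"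
  by (rule smooth_map_points[OF surj_submersionD(3)])

lemma Crl_iff:
  assumes "surj_submersion a"
  shows "F \<in> carrier (Crl a) \<longleftrightarrow> F \<in> extensional (points (sub_tot a)) \<and>
    (\<forall>q\<in>points (sub_tot a). F q \<in> {sub_proj a q} \<times> tangent_space (sub_st a) (sub_proj a q)) \<and>
    (\<forall>q\<in>points (sub_tot a). \<forall>\<kappa>\<in>charts_at (sub_st a) (sub_proj a q).
       smooth_fun_at (sub_tot a) (\<lambda>z. snd (F z) \<kappa>) q)"
  using smooth_section_iff[OF surj_submersionD[OF assms], of F]
  unfolding Crl_def Let_def by auto

lemma Crl_fibre:
  assumes "F \<in> carrier (Crl a)" "q \<in> points (sub_tot a)"
  shows "F q = (sub_proj a q, snd (F q))" "fst (F q) = sub_proj a q"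
    "snd (F q) \<in> tangent_space (sub_st a) (sub_proj a q)"
proof -
  have "F q \<in> {sub_proj a q} \<times> tangent_space (sub_st a) (sub_proj a q)"
    using assms unfolding Crl_def Let_def by auto
  then show "F q = (sub_proj a q, snd (F q))" "fst (F q) = sub_proj a q"
    "snd (F q) \<in> tangent_space (sub_st a) (sub_proj a q)" by (auto simp: prod_eq_iff)
qed

lemma Crl_eqI:
  assumes "F \<in> carrier (Crl a)" "G \<in> carrier (Crl a)"
    and "\<And>q. q \<in> points (sub_tot a) \<Longrightarrow> snd (F q) = snd (G q)"
  shows "F = G"
proof (rule extensionalityI)
  show "F \<in> extensional (points (sub_tot a))" "G \<in> extensional (points (sub_tot a))"
    using assms unfolding Crl_def Let_def by auto
  show "F q = G q" if "q \<in> points (sub_tot a)" for q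
    using Crl_fibre(2)[OF assms(1) that] Crl_fibre(2)[OF assms(2) that] assms(3)[OF that]
    by (simp add: prod_eq_iff)
qed

text \<open>
  The linear combination $r F + s G$. Addition, scaling and negation are instances, so closure, relatedness and
  compatibility with the pullback need only one proof each.
\<close>

definition system_combination ::
  "('x, 'd, 'y, 'e::real_normed_vector) submersion \<Rightarrow> real \<Rightarrow> ('x \<Rightarrow> ('y, 'e) tvec) \<Rightarrow> real \<Rightarrow>
   ('x \<Rightarrow> ('y, 'e) tvec) \<Rightarrow> 'x \<Rightarrow> ('y, 'e) tvec" where
  "system_combination a r F s G =
     (\<lambda>q\<in>points (sub_tot a). (sub_proj a q, \<lambda>\<kappa>. r *\<^sub>R snd (F q) \<kappa> + s *\<^sub>R snd (G q) \<kappa>))"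

text \<open>
  Scaling is written as $r F + 0 F$, so that no zero system has to be carried along.
\<close>

lemma Crl_ops:
  "add (Crl a) F G = system_combination a 1 F 1 G"
  "smult (Crl a) r F = system_combination a r F 0 F"
  "zero (Crl a) = (\<lambda>q\<in>points (sub_tot a). (sub_proj a q, \<lambda>\<kappa>. 0))"
  by (simp_all add: Crl_def Let_def system_combination_def)

lemma Crl_zero:
  assumes "surj_submersion a" shows "zero (Crl a) \<in> carrier (Crl a)"
  unfolding Crl_iff[OF assms] Crl_ops
proof (intro conjI ballI)
  fix q \<kappa> assume q: "q \<in> points (sub_tot a)"
  show "smooth_fun_at (sub_tot a)
      (\<lambda>z. snd ((\<lambda>q\<in>points (sub_tot a). (sub_proj a q, \<lambda>\<kappa>. 0)) z) \<kappa>) q"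
    by (rule smooth_fun_at_cong[OF surj_submersionD(1)[OF assms] openin_topspace q _ smooth_fun_at_const])
      simp
qed (simp_all add: tangent_space_zero[OF surj_submersionD(2)[OF assms]])

lemma system_combination_closed:
  assumes a: "surj_submersion a" and F: "F \<in> carrier (Crl a)" and G: "G \<in> carrier (Crl a)"
  shows "system_combination a r F s G \<in> carrier (Crl a)"
  unfolding Crl_iff[OF a]
proof (intro conjI ballI)
  fix q assume q: "q \<in> points (sub_tot a)"
  show "system_combination a r F s G q \<in> {sub_proj a q} \<times> tangent_space (sub_st a) (sub_proj a q)"
    using q tangent_space_combination[OF surj_submersionD(2)[OF a] Crl_fibre(3)[OF F q] Crl_fibre(3)[OF G q]]
    by (simp add: system_combination_def)
  fix \<kappa> assume "\<kappa> \<in> charts_at (sub_st a) (sub_proj a q)"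
  then have "smooth_fun_at (sub_tot a) (\<lambda>z. snd (F z) \<kappa>) q" "smooth_fun_at (sub_tot a) (\<lambda>z. snd (G z) \<kappa>) q"
    using F G q unfolding Crl_iff[OF a] by auto
  then have "smooth_fun_at (sub_tot a) (\<lambda>z. r *\<^sub>R snd (F z) \<kappa> + s *\<^sub>R snd (G z) \<kappa>) q"
    by (rule smooth_fun_at_add[OF smooth_fun_at_bounded_linear[OF bounded_linear_scaleR_right]
          smooth_fun_at_bounded_linear[OF bounded_linear_scaleR_right]])
  then show "smooth_fun_at (sub_tot a) (\<lambda>z. snd (system_combination a r F s G z) \<kappa>) q"
    by (rule smooth_fun_at_cong[OF surj_submersionD(1)[OF a] openin_topspace q, rotated])
      (simp add: system_combination_def)
qed (simp add: system_combination_def)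

lemma module_Crl:
  assumes a: "surj_submersion a"
  shows "module class_ring (Crl a)"
proof (rule module_criteria)
  note closed = system_combination_closed[OF a]
  show "cring (class_ring :: real ring)" by (rule domain.axioms(1)[OF field.axioms(1)[OF class_field]])
  show "zero (Crl a) \<in> carrier (Crl a)" by (rule Crl_zero[OF a])
  show "\<forall>v w. v \<in> carrier (Crl a) \<and> w \<in> carrier (Crl a) \<longrightarrow> add (Crl a) v w \<in> carrier (Crl a)"
    by (simp add: Crl_ops closed)
  show "\<forall>v\<in>carrier (Crl a). \<exists>neg_v\<in>carrier (Crl a). add (Crl a) v neg_v = zero (Crl a)"
  proof
    fix v assume v: "v \<in> carrier (Crl a)"
    show "\<exists>neg_v\<in>carrier (Crl a). add (Crl a) v neg_v = zero (Crl a)"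
      by (rule bexI[OF _ closed[OF v v, of "-1" 0]]) (auto simp: Crl_ops system_combination_def)
  qed
  show "\<forall>c v. c \<in> carrier class_ring \<and> v \<in> carrier (Crl a) \<longrightarrow> smult (Crl a) c v \<in> carrier (Crl a)"
    by (simp add: Crl_ops closed)
  note ext = system_combination_def restrict_def fun_eq_iff
  show "\<forall>v w. v \<in> carrier (Crl a) \<and> w \<in> carrier (Crl a) \<longrightarrow> add (Crl a) v w = add (Crl a) w v"
    by (simp add: Crl_ops ext add.commute)
  show "\<forall>v w x. v \<in> carrier (Crl a) \<and> w \<in> carrier (Crl a) \<and> x \<in> carrier (Crl a) \<longrightarrow>
      add (Crl a) (add (Crl a) v w) x = add (Crl a) v (add (Crl a) w x)"
    by (simp add: Crl_ops ext add.assoc)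
  show "\<forall>v\<in>carrier (Crl a). add (Crl a) v (zero (Crl a)) = v"
  proof
    fix v assume v: "v \<in> carrier (Crl a)"
    show "add (Crl a) v (zero (Crl a)) = v"
      by (rule Crl_eqI[OF _ v]) (simp_all add: Crl_ops(1) closed v Crl_zero[OF a],
        simp add: Crl_ops(3) system_combination_def)
  qed
  show "\<forall>v\<in>carrier (Crl a). smult (Crl a) (one class_ring) v = v"
  proof
    fix v assume v: "v \<in> carrier (Crl a)"
    show "smult (Crl a) (one class_ring) v = v"
      by (rule Crl_eqI[OF _ v]) (simp_all add: Crl_ops(2) closed v, simp add: system_combination_def)
  qed
  show "\<forall>r s v. r \<in> carrier class_ring \<and> s \<in> carrier class_ring \<and> v \<in> carrier (Crl a) \<longrightarrow>
      smult (Crl a) (mult class_ring r s) v = smult (Crl a) r (smult (Crl a) s v)"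
    by (simp add: Crl_ops ext)
  show "\<forall>r s v. r \<in> carrier class_ring \<and> s \<in> carrier class_ring \<and> v \<in> carrier (Crl a) \<longrightarrow>
      smult (Crl a) (add class_ring r s) v = add (Crl a) (smult (Crl a) r v) (smult (Crl a) s v)"
    by (simp add: Crl_ops ext scaleR_left_distrib)
  show "\<forall>r v w. r \<in> carrier class_ring \<and> v \<in> carrier (Crl a) \<and> w \<in> carrier (Crl a) \<longrightarrow>
      smult (Crl a) r (add (Crl a) v w) = add (Crl a) (smult (Crl a) r v) (smult (Crl a) r w)"
    by (simp add: Crl_ops ext scaleR_right_distrib)
qed

lemma vectorspace_Crl: "surj_submersion a \<Longrightarrow> vectorspace class_ring (Crl a)"
  by (rule vectorspace.intro[OF module_Crl class_field])

section \<open>Relatedness is linear\<close>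

lemma tangent_map_system_combination:
  assumes a: "surj_submersion a" and N: "manifold N" and f: "smooth_map (sub_st a) N f"
    and F: "F \<in> carrier (Crl a)" and G: "G \<in> carrier (Crl a)" and q: "q \<in> points (sub_tot a)"
  shows "tangent_map (sub_st a) N f (system_combination a r F s G q) =
    (f (sub_proj a q), \<lambda>\<kappa>. r *\<^sub>R snd (tangent_map (sub_st a) N f (F q)) \<kappa> +
      s *\<^sub>R snd (tangent_map (sub_st a) N f (G q)) \<kappa>)"
proof -
  have "system_combination a r F s G q = (sub_proj a q, \<lambda>\<kappa>. r *\<^sub>R snd (F q) \<kappa> + s *\<^sub>R snd (G q) \<kappa>)"
    using q by (simp add: system_combination_def)
  then show ?thesis
    using tangent_map_combination[OF surj_submersionD(2)[OF a] N f sub_proj_points[OF a q]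
        Crl_fibre(3)[OF F q] Crl_fibre(3)[OF G q], of r s]
    by (simp flip: Crl_fibre(1)[OF F q] Crl_fibre(1)[OF G q])
qed

lemma submersion_mapD:
  assumes "submersion_map a b f"
  shows "smooth_map (sub_tot a) (sub_tot b) (map_tot f)" "smooth_map (sub_st a) (sub_st b) (map_st f)"
    "\<And>q. q \<in> points (sub_tot a) \<Longrightarrow> map_tot f q \<in> points (sub_tot b)"
    "\<And>q. q \<in> points (sub_tot a) \<Longrightarrow> sub_proj b (map_tot f q) = map_st f (sub_proj a q)"
  using assms smooth_map_points[of "sub_tot a" "sub_tot b" "map_tot f"] by (simp_all add: submersion_map_def)

text \<open>
  The tangent map is linear on fibres, and on the other side the operations are pointwise as well.
\<close>

lemma related_combination:
  assumes a: "surj_submersion a" and b: "surj_submersion b" and f: "submersion_map a b f"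
    and F: "F \<in> carrier (Crl a)" "F' \<in> carrier (Crl a)" and "related a b f F G" "related a b f F' G'"
  shows "related a b f (system_combination a r F s F') (system_combination b r G s G')"
  unfolding related_def
proof
  fix q assume q: "q \<in> points (sub_tot a)"
  show "tangent_map (sub_st a) (sub_st b) (map_st f) (system_combination a r F s F' q) =
      system_combination b r G s G' (map_tot f q)"
    using tangent_map_system_combination[OF a surj_submersionD(2)[OF b] submersion_mapD(2)[OF f] F q]
      assms(6,7) q submersion_mapD(3,4)[OF f q]
    by (simp add: related_def system_combination_def)
qed

lemma related_zero:
  assumes a: "surj_submersion a" and b: "surj_submersion b" and f: "submersion_map a b f"
  shows "related a b f (zero (Crl a)) (zero (Crl b))"
  using tangent_map_zero[OF surj_submersionD(2)[OF a] surj_submersionD(2)[OF b] submersion_mapD(2)[OF f]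
      sub_proj_points[OF a]] submersion_mapD(3,4)[OF f]
  by (simp add: related_def Crl_ops)

lemma linear_relation_Crl_rel:
  assumes a: "surj_submersion a" and b: "surj_submersion b" and f: "submersion_map a b f"
  shows "linear_relation (Crl a) (Crl b) (Crl_rel a b f)"
  unfolding linear_relation_def
proof (intro conjI VectorSpace.subspace.intro submodule.intro)
  show "vectorspace class_ring (Crl a)" "vectorspace class_ring (Crl b)"
    by (rule vectorspace_Crl[OF a] vectorspace_Crl[OF b])+
  show m: "module class_ring (direct_sum (Crl b) (Crl a))"
    by (rule direct_sum_is_module[OF module_Crl[OF b] module_Crl[OF a]])
  then show "vectorspace class_ring (direct_sum (Crl b) (Crl a))"
    by (rule vectorspace.intro[OF _ class_field])
  show "Crl_rel a b f \<subseteq> carrier (direct_sum (Crl b) (Crl a))"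
    by (auto simp: Crl_rel_def direct_sum_def)
  show "zero (direct_sum (Crl b) (Crl a)) \<in> Crl_rel a b f"
    using Crl_zero[OF a] Crl_zero[OF b] related_zero[OF a b f] by (simp add: Crl_rel_def direct_sum_def)
  show "add (direct_sum (Crl b) (Crl a)) v w \<in> Crl_rel a b f"
    if "v \<in> Crl_rel a b f" "w \<in> Crl_rel a b f" for v w
    using that system_combination_closed[OF a] system_combination_closed[OF b] related_combination[OF a b f]
    by (auto simp: Crl_rel_def direct_sum_def Crl_ops)
  show "smult (direct_sum (Crl b) (Crl a)) r v \<in> Crl_rel a b f" if "v \<in> Crl_rel a b f" for r v
    using that system_combination_closed[OF a] system_combination_closed[OF b] related_combination[OF a b f]
    by (auto simp: Crl_rel_def direct_sum_def Crl_ops)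
qed

section \<open>Pullback along an interconnection morphism\<close>

lemma interconnection_inverse:
  assumes "interconnection a b f"
  shows "\<exists>g. smooth_map (sub_st b) (sub_st a) g \<and>
    (\<forall>y\<in>points (sub_st a). g (map_st f y) = y) \<and> (\<forall>y\<in>points (sub_st b). map_st f (g y) = y)"
  using assms unfolding interconnection_def diffeomorphism_def by blast

text \<open>
  Functoriality applied to $g \circ f = \mathrm{id}$.
\<close>

lemma tangent_map_inverse:
  fixes M :: "('m, 'd::euclidean_model) mfd" and N :: "('n, 'e::euclidean_model) mfd"
  assumes "manifold M" "manifold N" "smooth_map M N f" "smooth_map N M g"
    and "\<forall>y\<in>points M. g (f y) = y" and w: "w \<in> points (tangent_bundle M)"
  shows "tangent_map N M g (tangent_map M N f w) = w"
proof -
  obtain x v where xv: "w = (x, v)" "x \<in> points M" "v \<in> tangent_space M x"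
    using w unfolding points_tangent_bundle[OF assms(1)] by auto
  have "tangent_map N M g (tangent_map M N f (x, v)) = tangent_map M M (\<lambda>x. g (f x)) (x, v)"
    by (rule tangent_map_compose[OF assms(1,2,1,3,4) xv(2,3)])
  also have "\<dots> = tangent_map M M (\<lambda>x. x) (x, v)"
    by (rule tangent_map_cong[OF assms(1,5) xv(2)])
  also have "\<dots> = (x, v)"
    by (rule tangent_map_ident[OF assms(1) xv(2,3)])
  finally show ?thesis by (simp add: xv(1))
qed

lemma tangent_map_in_bundle:
  fixes M :: "('m, 'd::euclidean_model) mfd" and N :: "('n, 'e::euclidean_model) mfd"
  assumes "manifold M" "manifold N" "smooth_map M N f" "w \<in> points (tangent_bundle M)"
  shows "tangent_map M N f w \<in> points (tangent_bundle N)"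
proof -
  obtain x v where xv: "w = (x, v)" "x \<in> points M" "v \<in> tangent_space M x"
    using assms(4) unfolding points_tangent_bundle[OF assms(1)] by auto
  show ?thesis
    using tangent_map_in[OF assms(1-3) xv(2,3)] smooth_map_points[OF assms(3) xv(2)]
    unfolding points_tangent_bundle[OF assms(2)] xv(1) by (simp add: mem_Times_iff Sigma_def prod_eq_iff)
qed

lemma Crl_in_bundle:
  assumes "surj_submersion a" "F \<in> carrier (Crl a)" "q \<in> points (sub_tot a)"
  shows "F q \<in> points (tangent_bundle (sub_st a))"
  unfolding points_tangent_bundle[OF surj_submersionD(2)[OF assms(1)]]
  by (subst Crl_fibre(1)[OF assms(2,3)])
    (simp add: sub_proj_points[OF assms(1,3)] Crl_fibre(3)[OF assms(2,3)])

text \<open>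
  The set-theoretic inverse of $T(f_{st})$ in the definition of the pullback is the tangent map of
  the inverse diffeomorphism. This turns the pullback into an expression that can be
  differentiated.
\<close>

lemma pullback_eq:
  assumes a: "surj_submersion a" and b: "surj_submersion b" and f: "interconnection a b f"
    and g: "smooth_map (sub_st b) (sub_st a) g" "\<forall>y\<in>points (sub_st a). g (map_st f y) = y"
    "\<forall>y\<in>points (sub_st b). map_st f (g y) = y"
    and F: "F \<in> carrier (Crl b)" and q: "q \<in> points (sub_tot a)"
  shows "pullback a b f F q = tangent_map (sub_st b) (sub_st a) g (F (map_tot f q))"
proof -
  note Ma = surj_submersionD(2)[OF a] and Mb = surj_submersionD(2)[OF b]
  have fm: "submersion_map a b f" using f by (simp add: interconnection_def)
  note fs = submersion_mapD(2)[OF fm]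
  have w: "F (map_tot f q) \<in> points (tangent_bundle (sub_st b))"
    by (rule Crl_in_bundle[OF b F submersion_mapD(3)[OF fm q]])
  have "inj_on (tangent_map (sub_st a) (sub_st b) (map_st f)) (points (tangent_bundle (sub_st a)))"
    by (rule inj_on_inverseI) (rule tangent_map_inverse[OF Ma Mb fs g(1,2)])
  then have "inv_into (points (tangent_bundle (sub_st a))) (tangent_map (sub_st a) (sub_st b) (map_st f))
      (F (map_tot f q)) = tangent_map (sub_st b) (sub_st a) g (F (map_tot f q))"
    by (rule inv_into_f_eq) (rule tangent_map_in_bundle[OF Mb Ma g(1) w],
        rule tangent_map_inverse[OF Mb Ma g(1) fs g(3) w])
  then show ?thesis using q by (simp add: pullback_def)
qed

text \<open>
  Over each point the pulled back vector is the preimage under $T(f_{st})$ of the original one. In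
  this form the pullback enters the comparison of related systems.
\<close>

lemma tangent_map_pullback:
  assumes a: "surj_submersion a" and b: "surj_submersion b" and f: "interconnection a b f"
    and F: "F \<in> carrier (Crl b)" and q: "q \<in> points (sub_tot a)"
  shows "tangent_map (sub_st a) (sub_st b) (map_st f) (pullback a b f F q) = F (map_tot f q)"
proof -
  have fm: "submersion_map a b f" using f by (simp add: interconnection_def)
  obtain g where g: "smooth_map (sub_st b) (sub_st a) g" "\<forall>y\<in>points (sub_st a). g (map_st f y) = y"
    "\<forall>y\<in>points (sub_st b). map_st f (g y) = y"
    using interconnection_inverse[OF f] by blast
  show ?thesis
    unfolding pullback_eq[OF a b f g F q]
    by (rule tangent_map_inverse[OF surj_submersionD(2)[OF b] surj_submersionD(2)[OF a] g(1)
          submersion_mapD(2)[OF fm] g(3) Crl_in_bundle[OF b F submersion_mapD(3)[OF fm q]]])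
qed

text \<open>
  The pulled back system lies over the right base point because $g$ inverts $f_{st}$ and $f$ is
  compatible with the projections. For smoothness at \<open>q\<close>, fix charts \<open>\<kappa>\<close> around the state of \<open>q\<close> and
  \<open>\<kappa>'\<close> around the state of its image. On the open set \<open>?U\<close> of points that stay in both charts, the
  coordinates of the pulled back system are the derivative of the coordinate expression of $g$
  applied to the coordinates of $F$.
\<close>

lemma pullback_closed:
  assumes a: "surj_submersion a" and b: "surj_submersion b" and f: "interconnection a b f"
    and F: "F \<in> carrier (Crl b)"
  shows "pullback a b f F \<in> carrier (Crl a)"
  unfolding Crl_iff[OF a]
proof (intro conjI ballI)
  note Ta = surj_submersionD(1)[OF a] and Ma = surj_submersionD(2)[OF a] and pa = surj_submersionD(3)[OF a]
    and Tb = surj_submersionD(1)[OF b] and Mb = surj_submersionD(2)[OF b] and pb = surj_submersionD(3)[OF b]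
  have fm: "submersion_map a b f" using f by (simp add: interconnection_def)
  note ft = submersion_mapD(1)[OF fm]
  obtain g where g: "smooth_map (sub_st b) (sub_st a) g" "\<forall>y\<in>points (sub_st a). g (map_st f y) = y"
    "\<forall>y\<in>points (sub_st b). map_st f (g y) = y"
    using interconnection_inverse[OF f] by blast
  note eq = pullback_eq[OF a b f g F]
  show "pullback a b f F \<in> extensional (points (sub_tot a))"
    by (simp add: pullback_def)
  have base: "g (sub_proj b (map_tot f q)) = sub_proj a q" if "q \<in> points (sub_tot a)" for q
    using submersion_mapD(4)[OF fm that] g(2) sub_proj_points[OF a that] by simp
  fix q assume q: "q \<in> points (sub_tot a)"
  note fq = submersion_mapD(3)[OF fm q]
  show "pullback a b f F q \<in> {sub_proj a q} \<times> tangent_space (sub_st a) (sub_proj a q)"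
    using tangent_map_in[OF Mb Ma g(1) sub_proj_points[OF b fq] Crl_fibre(3)[OF F fq]]
    unfolding eq[OF q] Crl_fibre(1)[OF F fq, symmetric] base[OF q]
    by (simp add: mem_Times_iff Crl_fibre(2)[OF F fq] base[OF q])
  fix \<kappa> assume \<kappa>: "\<kappa> \<in> charts_at (sub_st a) (sub_proj a q)"
  obtain \<kappa>' where \<kappa>': "\<kappa>' \<in> charts_at (sub_st b) (sub_proj b (map_tot f q))"
    using charts_at_nonempty[OF Mb sub_proj_points[OF b fq]] by blast
  let ?U = "{z \<in> points (sub_tot a). sub_proj a z \<in> fst \<kappa>} \<inter>
    {z \<in> points (sub_tot a). sub_proj b (map_tot f z) \<in> fst \<kappa>'}"
  have pf: "smooth_map (sub_tot a) (sub_st b) (\<lambda>z. sub_proj b (map_tot f z))"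
    by (rule smooth_map_compose[OF Ta Tb Mb ft pb])
  have U: "openin (mtop (sub_tot a)) ?U"
    using charts_atD[OF \<kappa>] charts_atD[OF \<kappa>']
    by (intro openin_Int openin_continuous_map_preimage[OF smooth_mapD_cont[OF pa]]
        openin_continuous_map_preimage[OF smooth_mapD_cont[OF pf]]
        manifold_chart_domain_open[OF Ma] manifold_chart_domain_open[OF Mb]) simp_all
  have coord: "local_derivative \<kappa>' \<kappa> g (sub_proj b (map_tot f z)) (snd (F (map_tot f z)) \<kappa>') =
      snd (pullback a b f F z) \<kappa>" if "z \<in> ?U" for z
  proof -
    have z: "z \<in> points (sub_tot a)" "\<kappa> \<in> charts_at (sub_st a) (g (sub_proj b (map_tot f z)))"
      "\<kappa>' \<in> charts_at (sub_st b) (sub_proj b (map_tot f z))"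
      using that \<kappa> \<kappa>' base by (auto simp: charts_at_def)
    note fz = submersion_mapD(3)[OF fm z(1)]
    show ?thesis
      using tangent_map_coord[OF Mb Ma g(1) sub_proj_points[OF b fz] Crl_fibre(3)[OF F fz] z(3,2)]
      by (simp add: eq[OF z(1)] flip: Crl_fibre(1)[OF F fz])
  qed
  have "smooth_fun_at (sub_tot a)
      (\<lambda>z. local_derivative \<kappa>' \<kappa> g (sub_proj b (map_tot f z)) (snd (F (map_tot f z)) \<kappa>')) q"
  proof (rule smooth_fun_at_derivative_apply[OF Ta])
    show "smooth_fun_at (sub_tot a) (\<lambda>z. snd \<kappa>' (sub_proj b (map_tot f z))) q"
      by (rule smooth_map_chart[OF Ta Mb pf q \<kappa>'])
    show "smooth_fun_at (sub_tot a) (\<lambda>z. snd (F (map_tot f z)) \<kappa>') q"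
      using F fq \<kappa>' unfolding Crl_iff[OF b] by (intro smooth_fun_at_compose[OF Ta Tb ft q]) blast
    show "smooth_near (\<lambda>y. snd \<kappa> (g (chart_inv \<kappa>' y))) (snd \<kappa>' (sub_proj b (map_tot f q)))"
      using \<kappa> by (intro smooth_map_local_rep[OF Mb Ma g(1) sub_proj_points[OF b fq] \<kappa>']) (simp add: base[OF q])
  qed
  then show "smooth_fun_at (sub_tot a) (\<lambda>z. snd (pullback a b f F z) \<kappa>) q"
    by (rule smooth_fun_at_cong[OF Ta U, rotated 2])
      (use q charts_atD[OF \<kappa>] charts_atD[OF \<kappa>'] coord in auto)
qed

lemma pullback_combination:
  assumes a: "surj_submersion a" and b: "surj_submersion b" and f: "interconnection a b f"
    and F: "F \<in> carrier (Crl b)" and G: "G \<in> carrier (Crl b)"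
  shows "pullback a b f (system_combination b r F s G) =
    system_combination a r (pullback a b f F) s (pullback a b f G)"
proof (rule Crl_eqI[of _ a])
  note closed = pullback_closed[OF a b f]
  show "pullback a b f (system_combination b r F s G) \<in> carrier (Crl a)"
    by (rule closed[OF system_combination_closed[OF b F G]])
  show "system_combination a r (pullback a b f F) s (pullback a b f G) \<in> carrier (Crl a)"
    by (rule system_combination_closed[OF a closed[OF F] closed[OF G]])
  have fm: "submersion_map a b f" using f by (simp add: interconnection_def)
  obtain g where g: "smooth_map (sub_st b) (sub_st a) g" "\<forall>y\<in>points (sub_st a). g (map_st f y) = y"
    "\<forall>y\<in>points (sub_st b). map_st f (g y) = y"
    using interconnection_inverse[OF f] by blast
  note eq = pullback_eq[OF a b f g]
  fix q assume q: "q \<in> points (sub_tot a)"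
  show "snd (pullback a b f (system_combination b r F s G) q) =
      snd (system_combination a r (pullback a b f F) s (pullback a b f G) q)"
    using q
    by (simp add: eq[OF _ q] F G system_combination_closed[OF b F G]
      tangent_map_system_combination[OF b surj_submersionD(2)[OF a] g(1) F G submersion_mapD(3)[OF fm q]])
      (simp add: system_combination_def eq[OF _ q] F G)
qed

lemma linear_map_pullback:
  assumes a: "surj_submersion a" and b: "surj_submersion b" and f: "interconnection a b f"
  shows "linear_map class_ring (Crl b) (Crl a) (pullback a b f)"
proof (intro linear_map.intro mod_hom.intro mod_hom_axioms.intro)
  show "vectorspace class_ring (Crl a)" "vectorspace class_ring (Crl b)"
    by (rule vectorspace_Crl[OF a] vectorspace_Crl[OF b])+
  show "module class_ring (Crl a)" "module class_ring (Crl b)"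
    by (rule module_Crl[OF a] module_Crl[OF b])+
  show "pullback a b f \<in> module_hom class_ring (Crl b) (Crl a)"
    unfolding module_hom_def
    by (simp add: pullback_closed[OF a b f] Crl_ops pullback_combination[OF a b f])
qed

section \<open>Pullback preserves relatedness\<close>

text \<open>
  Both sides lie in the tangent bundle over the states of \<open>c\<close>, where $T\psi_{st}$ is injective; the
  chain of equations computes their images under $T\psi_{st}$.
\<close>

lemma pullback_related:
  assumes a: "surj_submersion a" and b: "surj_submersion b"
    and c: "surj_submersion c" and d: "surj_submersion d"
    and \<mu>: "submersion_map a b \<mu>" and \<nu>: "submersion_map d c \<nu>"
    and \<psi>: "interconnection c b \<psi>" and \<phi>: "interconnection d a \<phi>"
    and comm: "submap_eq d (submap_comp \<psi> \<nu>) (submap_comp \<mu> \<phi>)"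
    and F: "F \<in> carrier (Crl a)" and G: "G \<in> carrier (Crl b)" and FG: "related a b \<mu> F G"
  shows "related d c \<nu> (pullback d a \<phi> F) (pullback c b \<psi> G)"
  unfolding related_def
proof
  note Ma = surj_submersionD(2)[OF a] and Mb = surj_submersionD(2)[OF b]
    and Mc = surj_submersionD(2)[OF c] and Md = surj_submersionD(2)[OF d]
  have \<psi>m: "submersion_map c b \<psi>" and \<phi>m: "submersion_map d a \<phi>"
    using \<psi> \<phi> by (simp_all add: interconnection_def)
  note \<mu>s = submersion_mapD(2)[OF \<mu>] and \<nu>s = submersion_mapD(2)[OF \<nu>]
    and \<psi>s = submersion_mapD(2)[OF \<psi>m] and \<phi>s = submersion_mapD(2)[OF \<phi>m]
  fix q assume q: "q \<in> points (sub_tot d)"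
  let ?F = "pullback d a \<phi> F" and ?G = "pullback c b \<psi> G"
  have F': "?F \<in> carrier (Crl d)" by (rule pullback_closed[OF d a \<phi> F])
  have G': "?G \<in> carrier (Crl c)" by (rule pullback_closed[OF c b \<psi> G])
  note \<phi>q = submersion_mapD(3)[OF \<phi>m q] and \<nu>q = submersion_mapD(3)[OF \<nu> q]
  have w: "?F q \<in> points (tangent_bundle (sub_st d))" by (rule Crl_in_bundle[OF d F' q])
  have Fq: "?F q = (sub_proj d q, snd (?F q))" "sub_proj d q \<in> points (sub_st d)"
    "snd (?F q) \<in> tangent_space (sub_st d) (sub_proj d q)"
    using Crl_fibre[OF F' q] sub_proj_points[OF d q] by auto
  let ?T\<psi> = "tangent_map (sub_st c) (sub_st b) (map_st \<psi>)"
  have "?T\<psi> (tangent_map (sub_st d) (sub_st c) (map_st \<nu>) (?F q)) =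
      tangent_map (sub_st d) (sub_st b) (\<lambda>y. map_st \<psi> (map_st \<nu> y)) (?F q)"
    using tangent_map_compose[OF Md Mc Mb \<nu>s \<psi>s Fq(2,3)] by (simp flip: Fq(1))
  also have "\<dots> = tangent_map (sub_st d) (sub_st b) (\<lambda>y. map_st \<mu> (map_st \<phi> y)) (?F q)"
  proof -
    have "\<forall>y\<in>points (sub_st d). map_st \<psi> (map_st \<nu> y) = map_st \<mu> (map_st \<phi> y)"
      using comm by (simp add: submap_eq_def submap_comp_def)
    from tangent_map_cong[OF Md this Fq(2), of "sub_st b" "snd (?F q)"]
    show ?thesis by (simp flip: Fq(1))
  qed
  also have "\<dots> = tangent_map (sub_st a) (sub_st b) (map_st \<mu>)
      (tangent_map (sub_st d) (sub_st a) (map_st \<phi>) (?F q))"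
    using tangent_map_compose[OF Md Ma Mb \<phi>s \<mu>s Fq(2,3)] by (simp flip: Fq(1))
  also have "\<dots> = tangent_map (sub_st a) (sub_st b) (map_st \<mu>) (F (map_tot \<phi> q))"
    by (simp only: tangent_map_pullback[OF d a \<phi> F q])
  also have "\<dots> = G (map_tot \<mu> (map_tot \<phi> q))"
    using FG \<phi>q by (simp add: related_def)
  also have "\<dots> = G (map_tot \<psi> (map_tot \<nu> q))"
    using comm q by (simp add: submap_eq_def submap_comp_def)
  also have "\<dots> = ?T\<psi> (?G (map_tot \<nu> q))"
    by (simp only: tangent_map_pullback[OF c b \<psi> G \<nu>q])
  finally have eq: "?T\<psi> (tangent_map (sub_st d) (sub_st c) (map_st \<nu>) (?F q)) = ?T\<psi> (?G (map_tot \<nu> q))" .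
  obtain g where g: "smooth_map (sub_st b) (sub_st c) g" "\<forall>y\<in>points (sub_st c). g (map_st \<psi> y) = y"
    "\<forall>y\<in>points (sub_st b). map_st \<psi> (g y) = y"
    using interconnection_inverse[OF \<psi>] by blast
  have "inj_on ?T\<psi> (points (tangent_bundle (sub_st c)))"
    by (rule inj_on_inverseI) (rule tangent_map_inverse[OF Mc Mb \<psi>s g(1,2)])
  from inj_onD[OF this eq tangent_map_in_bundle[OF Md Mc \<nu>s w] Crl_in_bundle[OF c G' \<nu>q]]
  show "tangent_map (sub_st d) (sub_st c) (map_st \<nu>) (?F q) = ?G (map_tot \<nu> q)" .
qed

theorem lemma8p12:
  fixes a :: "('xa, 'da::euclidean_model, 'ya, 'ea::euclidean_model) submersion"
    and b :: "('xb, 'db::euclidean_model, 'yb, 'eb::euclidean_model) submersion"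
    and c :: "('xc, 'dc::euclidean_model, 'yc, 'ec::euclidean_model) submersion"
    and d :: "('xd, 'dd::euclidean_model, 'yd, 'ed::euclidean_model) submersion"
    and \<mu> :: "('xa, 'ya, 'xb, 'yb) submap" and \<nu> :: "('xd, 'yd, 'xc, 'yc) submap"
    and \<psi> :: "('xc, 'yc, 'xb, 'yb) submap" and \<phi> :: "('xd, 'yd, 'xa, 'ya) submap"
  assumes "surj_submersion a" and "surj_submersion b"
    and "surj_submersion c" and "surj_submersion d"
    and "submersion_map a b \<mu>" and "submersion_map d c \<nu>"
    and "interconnection c b \<psi>" and "interconnection d a \<phi>"
    and "submap_eq d (submap_comp \<psi> \<nu>) (submap_comp \<mu> \<phi>)"
  shows "vect_two_cell (Crl a) (Crl b) (Crl_rel a b \<mu>) (Crl d) (Crl c) (Crl_rel d c \<nu>)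
           (pullback d a \<phi>) (pullback c b \<psi>) \<and>
         (\<forall>F\<in>carrier (Crl a). \<forall>G\<in>carrier (Crl b).
           related a b \<mu> F G \<longrightarrow> related d c \<nu> (pullback d a \<phi> F) (pullback c b \<psi> G))"
proof
  have "map_prod (pullback c b \<psi>) (pullback d a \<phi>) ` Crl_rel a b \<mu> \<subseteq> Crl_rel d c \<nu>"
    using pullback_related[OF assms] pullback_closed[OF assms(3,2,7)] pullback_closed[OF assms(4,1,8)]
    by (auto simp: Crl_rel_def)
  then show "vect_two_cell (Crl a) (Crl b) (Crl_rel a b \<mu>) (Crl d) (Crl c) (Crl_rel d c \<nu>)
      (pullback d a \<phi>) (pullback c b \<psi>)"
    unfolding vect_two_cell_def
    using linear_relation_Crl_rel[OF assms(1,2,5)] linear_relation_Crl_rel[OF assms(4,3,6)]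
      linear_map_pullback[OF assms(4,1,8)] linear_map_pullback[OF assms(3,2,7)] by blast
  show "\<forall>F\<in>carrier (Crl a). \<forall>G\<in>carrier (Crl b).
      related a b \<mu> F G \<longrightarrow> related d c \<nu> (pullback d a \<phi> F) (pullback c b \<psi> G)"
    using pullback_related[OF assms] by blast
qed

end
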